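(* Let $\mathbf W_t=(Z_t,X_t,Y_t)^\top$, $t\in\mathbb Z$, follow the stochastic recurrence equation $\mathbf W_t=\mathbf A_t\mathbf W_{t-1}+\mathbf B_t$ with $(\mathbf A_t,\mathbf B_t)_{t\in\mathbb Z}$ i.i.d. and entries denoted as in the context, and assume: (B1) $\mathbb E[\log\|\mathbf A_t\|]<0$ and $\mathbb E[\log^+|\mathbf B_t|]<\infty$; (B2) $\varepsilon_t^z,\varepsilon_t^x,\varepsilon_t^y$ are independent for all $t\in\mathbb Z$; (B4) $A^i_{j,t}>0$ almost surely for all $t\in\mathbb Z$ and all $j\in\{1,2,3\}$, $i\in\{z,x,y\}$ satisfying $P(A^i_{j,t}=0)\ne 1$. Then: (1) If $\lim_{v\to\infty}P(Z_t>-av\mid X_t>v,\mathbf Y_{\mathrm{past}(t)})=1$ for every $a>0$, then $$\Gamma_{\mathbf X\to\mathbf Y\mid\mathcal C}=1\implies\Gamma_{\mathbf X\to\mathbf Y\mid\emptyset}=1.$$ (2) If each of the pairs $(A^x_{1,t},B^x_t)$, $(A^x_{2,t},B^x_t)$, $(A^x_{3,t},B^x_t)$ satisfies the Grey assumption with index $\alpha_x$, and $\limsup_{u\to\infty}\frac{P(X_t>u\mid\mathbf Y_{\mathrm{past}(t)})}{P(B^x_t>u)}<\infty$ almost surely, then $$\Gamma_{\mathbf X\to\mathbf Y\mid\emptyset}=1\implies\Gamma_{\mathbf X\to\mathbf Y\mid\mathcal C}=1.$$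
   Context: Notation. $X_t,Y_t,Z_t$ are real-valued. $\mathbf A_t$ is the $3\times3$ random matrix whose rows are $(A^z_{1,t},A^z_{2,t},A^z_{3,t})$, $(A^x_{1,t},A^x_{2,t},A^x_{3,t})$, $(A^y_{1,t},A^y_{2,t},A^y_{3,t})$, and $\mathbf B_t=(B^z_t,B^x_t,B^y_t)^\top$; so e.g. $Y_t=A^y_{1,t}Z_{t-1}+A^y_{2,t}X_{t-1}+A^y_{3,t}Y_{t-1}+B^y_t$. For $i\in\{z,x,y\}$, $\varepsilon^i_t=(A^i_{1,t},A^i_{2,t},A^i_{3,t},B^i_t)^\top$. The variables $B^x_t,B^y_t$ are supported on some neighborhood of infinity. $\|\cdot\|$ is the operator norm, $\log^+x=\max\{\log x,0\}$. Under (B1), $\mathbf W$ is the strictly stationary ergodic solution $\mathbf W_t=\sum_{i\ge0}\mathbf A_t\mathbf A_{t-1}\cdots\mathbf A_{t-i+1}\mathbf B_{t-i}$ (empty product is the identity). Coefficients. $\mathrm{past}(t)=(t,t-1,\dots)$, $\mathcal C^{-\mathbf X}_t=\sigma(\mathbf Y_{\mathrm{past}(t)},\mathbf Z_{\mathrm{past}(t)})$. $F$ is a cumulative distribution function with $F(x)<1$ for all $x\in\mathbb R$. $\Gamma_{\mathbf X\to\mathbf Y\mid\mathcal C}=\lim_{v\to\infty}\mathbb E[F(Y_{t+1})\mid X_t>v,\mathcal C_t^{-\mathbf X}]$ and $\Gamma_{\mathbf X\to\mathbf Y\mid\emptyset}=\lim_{v\to\infty}\mathbb E[F(Y_{t+1})\mid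 X_t>v,\sigma(\mathbf Y_{\mathrm{past}(t)})]$, the limits being assumed to exist almost surely; by stationarity $t$ is irrelevant, and equalities "$=1$" are in the almost sure sense. Here $\mathbb E[\,\cdot\mid X_t>v,\mathcal G]=\mathbb E[\,\cdot\,\mathbf 1\{X_t>v\}\mid\mathcal G]/P(X_t>v\mid\mathcal G)$. Grey assumption with index $\alpha$ for a pair of real random variables $(A,B)$: $\alpha>0$, $\mathbb E|A|^\alpha<1$, $\mathbb E|A|^{\alpha+\nu}<\infty$ for some $\nu>0$, and $P(B>x)\sim p_\alpha x^{-\alpha}l(x)$, $P(-B>x)\sim q_\alpha x^{-\alpha}l(x)$ as $x\to\infty$, with $p_\alpha,q_\alpha\ge0$, $p_\alpha\ne0$, $p_\alpha+q_\alpha=1$ and $l$ slowly varying (i.e. $l(cx)/l(x)\to1$ as $x\to\infty$ for every $c>0$). *)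

theory Defs
  imports "HOL-Probability.Probability"
begin

section \<open>The stochastic recurrence equation\<close>

text \<open>Vectors in three dimensions are ordered as \<open>(z, x, y)\<close>: component 1 belongs to \<open>Z\<close>,
  component 2 to \<open>X\<close>, component 3 to \<open>Y\<close>. Thus \<open>A t \<omega> $ i $ j\<close> is $A^i_{j,t}$ with \<open>i = 1, 2, 3\<close>
  standing for $z, x, y$, and $\varepsilon^i_t$ is the pair \<open>(A t \<omega> $ i, B t \<omega> $ i)\<close>.\<close>

text \<open>\<open>back_prod a t i\<close> is $a_t a_{t-1} \cdots a_{t-i+1}$.\<close>

primrec back_prod :: "(int \<Rightarrow> real^3^3) \<Rightarrow> int \<Rightarrow> nat \<Rightarrow> real^3^3" where
  "back_prod a t 0 = mat 1"
| "back_prod a t (Suc i) = back_prod a t i ** a (t - int i)"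

text \<open>The logarithm with $\log 0 = -\infty$ (in contrast to \<open>ln 0 = 0\<close>), and the expectation of an
  extended-real random variable as the difference of the expectations of its positive and negative
  parts, so that $E[\log \|A\|] = -\infty$ is allowed. Since $\infty - \infty = \infty$ in \<open>ereal\<close>, a
  negative value entails that the positive part is integrable.\<close>

definition ereal_log :: "real \<Rightarrow> ereal" where
  "ereal_log x = (if x > 0 then ereal (ln x) else -\<infinity>)"

definition ereal_expectation :: "'w measure \<Rightarrow> ('w \<Rightarrow> ereal) \<Rightarrow> ereal" where
  "ereal_expectation M f =
     enn2ereal (\<integral>\<^sup>+\<omega>. e2ennreal (f \<omega>) \<partial>M) - enn2ereal (\<integral>\<^sup>+\<omega>. e2ennreal (- f \<omega>) \<partial>M)"

definition iid_family :: "'w measure \<Rightarrow> ('i \<Rightarrow> 'w \<Rightarrow> 'b::topological_space) \<Rightarrow> bool" where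
  "iid_family M V \<longleftrightarrow>
     prob_space.indep_vars M (\<lambda>_. borel) V UNIV \<and>
     (\<forall>s t. distr M borel (V s) = distr M borel (V t))"

definition measure_support :: "'b::topological_space measure \<Rightarrow> 'b set" where
  "measure_support \<mu> = {x. \<forall>U. open U \<longrightarrow> x \<in> U \<longrightarrow> emeasure \<mu> U > 0}"

text \<open>The support of the random variable contains some half-line \<open>{c<..}\<close>; it need not be contained
  in it.\<close>

definition supported_near_infinity :: "'w measure \<Rightarrow> ('w \<Rightarrow> real) \<Rightarrow> bool" where
  "supported_near_infinity M V \<longleftrightarrow> (\<exists>c. {c<..} \<subseteq> measure_support (distr M borel V))"

section \<open>Grey's assumption\<close>

definition slowly_varying :: "(real \<Rightarrow> real) \<Rightarrow> bool" where
  "slowly_varying l \<longleftrightarrow> (\<forall>c>0. ((\<lambda>x. l (c * x) / l x) \<longlongrightarrow> 1) at_top)"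

text \<open>The relation $P(\pm B > x) \sim p\, x^{-\alpha} l(x)$ is expressed by convergence of the quotient
  to $p$, which gives it the usual meaning $o(x^{-\alpha} l(x))$ when the constant is 0.\<close>

definition grey :: "'w measure \<Rightarrow> real \<Rightarrow> ('w \<Rightarrow> real) \<Rightarrow> ('w \<Rightarrow> real) \<Rightarrow> bool" where
  "grey M \<alpha> A B \<longleftrightarrow>
     \<alpha> > 0 \<and>
     (\<integral>\<^sup>+\<omega>. ennreal (\<bar>A \<omega>\<bar> powr \<alpha>) \<partial>M) < 1 \<and>
     (\<exists>\<nu>>0. (\<integral>\<^sup>+\<omega>. ennreal (\<bar>A \<omega>\<bar> powr (\<alpha> + \<nu>)) \<partial>M) < \<infinity>) \<and>
     (\<exists>p q l. p \<ge> 0 \<and> q \<ge> 0 \<and> p \<noteq> 0 \<and> p + q = 1 \<and> slowly_varying l \<and>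
        ((\<lambda>x. measure M {\<omega> \<in> space M. B \<omega> > x} / (x powr (- \<alpha>) * l x)) \<longlongrightarrow> p) at_top \<and>
        ((\<lambda>x. measure M {\<omega> \<in> space M. - B \<omega> > x} / (x powr (- \<alpha>) * l x)) \<longlongrightarrow> q) at_top)"

section \<open>Conditional expectations and their limits\<close>

text \<open>The sigma-algebra generated by \<open>W s $ i\<close> for \<open>s \<le> t\<close> and \<open>i \<in> I\<close>: for \<open>I = {3}\<close> it is
  generated by the past of \<open>Y\<close>, for \<open>I = {1, 3}\<close> by the pasts of \<open>Y\<close> and \<open>Z\<close>.\<close>

definition past_sigma :: "'w measure \<Rightarrow> (int \<Rightarrow> 'w \<Rightarrow> real^3) \<Rightarrow> 3 set \<Rightarrow> int \<Rightarrow> 'w measure" where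
  "past_sigma M W I t =
     sigma (space M)
       {(\<lambda>\<omega>. W s \<omega> $ i) -` S \<inter> space M | s i S. s \<le> t \<and> i \<in> I \<and> S \<in> sets borel}"

text \<open>The conditional expectation of \<open>f\<close> given the event \<open>E\<close> and the sub-sigma-algebra \<open>G\<close>.\<close>

definition cond_exp_event ::
    "'w measure \<Rightarrow> 'w measure \<Rightarrow> ('w \<Rightarrow> real) \<Rightarrow> 'w set \<Rightarrow> 'w \<Rightarrow> real" where
  "cond_exp_event M G f E \<omega> =
     real_cond_exp M G (\<lambda>\<omega>'. f \<omega>' * indicator E \<omega>') \<omega> / real_cond_exp M G (indicator E) \<omega>"

text \<open>For each threshold \<open>v\<close> a conditional expectation is determined only up to a null set depending
  on \<open>v\<close>, so almost sure limits as the real variable \<open>v\<close> tends to infinity refer to a suitable choice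
  of versions. Any two such choices agree almost surely for all natural \<open>v\<close> simultaneously, so the
  almost sure limit does not depend on the choice.\<close>

definition versions ::
    "'w measure \<Rightarrow> (real \<Rightarrow> 'w \<Rightarrow> real) \<Rightarrow> (real \<Rightarrow> 'w \<Rightarrow> real) \<Rightarrow> bool" where
  "versions M R R' \<longleftrightarrow> (\<forall>v. AE \<omega> in M. R' v \<omega> = R v \<omega>)"

definition as_limit :: "'w measure \<Rightarrow> (real \<Rightarrow> 'w \<Rightarrow> real) \<Rightarrow> ('w \<Rightarrow> real) \<Rightarrow> bool" where
  "as_limit M R L \<longleftrightarrow>
     (\<exists>R'. versions M R R' \<and> (AE \<omega> in M. ((\<lambda>v. R' v \<omega>) \<longlongrightarrow> L \<omega>) at_top))"

definition as_limsup_finite :: "'w measure \<Rightarrow> (real \<Rightarrow> 'w \<Rightarrow> real) \<Rightarrow> bool" where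
  "as_limsup_finite M R \<longleftrightarrow>
     (\<exists>R'. versions M R R' \<and> (AE \<omega> in M. Limsup at_top (\<lambda>v. ereal (R' v \<omega>)) < \<infinity>))"

lemma as_limit_unique:
  assumes "as_limit M R L" and "as_limit M R L'"
  shows "AE \<omega> in M. L \<omega> = L' \<omega>"
proof -
  obtain S S' where S: "versions M R S" "AE \<omega> in M. ((\<lambda>v. S v \<omega>) \<longlongrightarrow> L \<omega>) at_top"
    and S': "versions M R S'" "AE \<omega> in M. ((\<lambda>v. S' v \<omega>) \<longlongrightarrow> L' \<omega>) at_top"
    using assms unfolding as_limit_def by blast
  have "AE \<omega> in M. \<forall>n. S (real n) \<omega> = R (real n) \<omega>"
    and "AE \<omega> in M. \<forall>n. S' (real n) \<omega> = R (real n) \<omega>"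
    using S(1) S'(1) unfolding versions_def AE_all_countable by blast+
  with S(2) S'(2) show ?thesis
  proof eventually_elim
    case (elim \<omega>)
    have "(\<lambda>n. R (real n) \<omega>) \<longlonglongrightarrow> L \<omega>"
      using filterlim_compose[OF elim(1) filterlim_real_sequentially] elim(3) by simp
    moreover have "(\<lambda>n. R (real n) \<omega>) \<longlonglongrightarrow> L' \<omega>"
      using filterlim_compose[OF elim(2) filterlim_real_sequentially] elim(4) by simp
    ultimately show ?case
      by (rule LIMSEQ_unique)
  qed
qed

text \<open>\<open>extremal_coeff M W F I t \<Gamma>\<close>: the limit of $E[F(Y_{t+1}) \mid X_t > v, G]$ as $v \to \infty$ exists
  almost surely and equals \<open>\<Gamma>\<close>, where \<open>G = past_sigma M W I t\<close>.\<close>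

definition extremal_coeff ::
    "'w measure \<Rightarrow> (int \<Rightarrow> 'w \<Rightarrow> real^3) \<Rightarrow> (real \<Rightarrow> real) \<Rightarrow> 3 set \<Rightarrow> int \<Rightarrow> ('w \<Rightarrow> real) \<Rightarrow> bool" where
  "extremal_coeff M W F I t \<Gamma> \<longleftrightarrow>
     as_limit M
       (\<lambda>v. cond_exp_event M (past_sigma M W I t)
              (\<lambda>\<omega>. F (W (t + 1) \<omega> $ 3)) {\<omega> \<in> space M. W t \<omega> $ 2 > v})
       \<Gamma>"

end

theory Submission
  imports Defs
begin

text \<open>Given the past up to time \<open>t\<close>, the coefficients of the equation for \<open>Y\<close> at time \<open>t + 1\<close> are
  independent of everything else, so $E[F(Y_{t+1}) 1\{X_t > v\} \mid G] = E[g(W_t) 1\{X_t > v\} \mid G]$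
  with $g(w) = E F(A^y w + B^y) < 1$, and \<open>g\<close> is monotone in each coordinate. By (B4) the coefficient
  $A^y_2$ of \<open>X\<close> either vanishes almost surely or is almost surely positive.

  If it is positive, a large value of $X_t$ pushes $g(W_t)$ to 1, unless $Z_t$ is very negative or the
  conditioning event has conditional probability 0; the first obstruction concerns only the
  smaller sigma-algebra and is excluded by the hypothesis of (1), the second one by Grey's assumption.

  If it vanishes, \<open>g\<close> depends on $(Z_t, Y_t)$ only. Given the pasts of \<open>Y\<close> and \<open>Z\<close>, the coefficient is
  at most $g(W_t) < 1$. Given the past of \<open>Y\<close> alone, it can reach 1 only if $Z_t$ escapes to infinity
  when $X_t$ is large. But on \<open>{Z\<^sub>t \<le> K, |W\<^sub>t\<^sub>-\<^sub>1| \<le> K}\<close> the event $X_t > v$ has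
  conditional probability at least $c\, P(B^x > v)$ because $B^x$ has a heavier tail than $A^x$, and
  by the limsup condition this is a nonvanishing fraction of $P(X_t > v \mid G)$.

  The limits are taken along $v = 2^n$, where the comparison of the two tails is a ratio test.\<close>

section \<open>Independence and conditional expectation\<close>

text \<open>In contrast to \<open>indep_var\<close>, the two random variables may take values in different types.\<close>

definition (in prob_space) indep_rv :: "'b measure \<Rightarrow> ('a \<Rightarrow> 'b) \<Rightarrow> 'c measure \<Rightarrow> ('a \<Rightarrow> 'c) \<Rightarrow> bool" where
  "indep_rv N V K U \<longleftrightarrow> V \<in> measurable M N \<and> U \<in> measurable M K \<and>
     (\<forall>S\<in>sets N. \<forall>D\<in>sets K. emeasure M {\<omega> \<in> space M. V \<omega> \<in> S \<and> U \<omega> \<in> D} =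
        emeasure M {\<omega> \<in> space M. V \<omega> \<in> S} * emeasure M {\<omega> \<in> space M. U \<omega> \<in> D})"

context prob_space
begin

lemma indep_rvD:
  assumes "indep_rv N V K U"
  shows "V \<in> measurable M N" "U \<in> measurable M K"
    "\<And>S D. S \<in> sets N \<Longrightarrow> D \<in> sets K \<Longrightarrow> emeasure M {\<omega> \<in> space M. V \<omega> \<in> S \<and> U \<omega> \<in> D} =
        emeasure M {\<omega> \<in> space M. V \<omega> \<in> S} * emeasure M {\<omega> \<in> space M. U \<omega> \<in> D}"
  using assms by (auto simp: indep_rv_def)

lemma indep_var_imp_indep_rv:
  assumes ind: "indep_var N V K U"
  shows "indep_rv N V K U"
  unfolding indep_rv_def
proof (intro conjI ballI)
  fix S D assume "S \<in> sets N" "D \<in> sets K"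
  then have "prob ((\<lambda>x. (V x, U x)) -` (S \<times> D) \<inter> space M) = prob (V -` S \<inter> space M) * prob (U -` D \<inter> space M)"
    by (rule indep_varD[OF ind])
  moreover have "(\<lambda>x. (V x, U x)) -` (S \<times> D) \<inter> space M = {\<omega> \<in> space M. V \<omega> \<in> S \<and> U \<omega> \<in> D}"
    "V -` S \<inter> space M = {\<omega> \<in> space M. V \<omega> \<in> S}" "U -` D \<inter> space M = {\<omega> \<in> space M. U \<omega> \<in> D}"
    by auto
  ultimately show "emeasure M {\<omega> \<in> space M. V \<omega> \<in> S \<and> U \<omega> \<in> D} =
        emeasure M {\<omega> \<in> space M. V \<omega> \<in> S} * emeasure M {\<omega> \<in> space M. U \<omega> \<in> D}"
    by (simp add: emeasure_eq_measure ennreal_mult)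
qed (rule indep_var_rv1[OF ind] indep_var_rv2[OF ind])+

lemma indep_rv_sym: "indep_rv N V K U \<Longrightarrow> indep_rv K U N V"
  unfolding indep_rv_def by (simp add: conj_commute mult.commute)

lemma indep_rv_compose:
  assumes ind: "indep_rv N V K U" and f: "f \<in> measurable N N'" and g: "g \<in> measurable K K'"
  shows "indep_rv N' (\<lambda>\<omega>. f (V \<omega>)) K' (\<lambda>\<omega>. g (U \<omega>))"
  unfolding indep_rv_def
proof (intro conjI ballI)
  note V = indep_rvD(1)[OF ind] and U = indep_rvD(2)[OF ind]
  show "(\<lambda>\<omega>. f (V \<omega>)) \<in> measurable M N'" "(\<lambda>\<omega>. g (U \<omega>)) \<in> measurable M K'"
    using V U f g by measurable
  fix S D assume S: "S \<in> sets N'" and D: "D \<in> sets K'"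
  have "V \<omega> \<in> space N" "U \<omega> \<in> space K" if "\<omega> \<in> space M" for \<omega>
    using measurable_space[OF V that] measurable_space[OF U that] .
  then have "{\<omega> \<in> space M. V \<omega> \<in> f -` S \<inter> space N} = {\<omega> \<in> space M. f (V \<omega>) \<in> S}"
    "{\<omega> \<in> space M. U \<omega> \<in> g -` D \<inter> space K} = {\<omega> \<in> space M. g (U \<omega>) \<in> D}"
    "{\<omega> \<in> space M. V \<omega> \<in> f -` S \<inter> space N \<and> U \<omega> \<in> g -` D \<inter> space K} =
      {\<omega> \<in> space M. f (V \<omega>) \<in> S \<and> g (U \<omega>) \<in> D}"
    by auto
  moreover have "emeasure M {\<omega> \<in> space M. V \<omega> \<in> f -` S \<inter> space N \<and> U \<omega> \<in> g -` D \<inter> space K} =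
      emeasure M {\<omega> \<in> space M. V \<omega> \<in> f -` S \<inter> space N} * emeasure M {\<omega> \<in> space M. U \<omega> \<in> g -` D \<inter> space K}"
    by (rule indep_rvD(3)[OF ind measurable_sets[OF f S] measurable_sets[OF g D]])
  ultimately show "emeasure M {\<omega> \<in> space M. f (V \<omega>) \<in> S \<and> g (U \<omega>) \<in> D} =
        emeasure M {\<omega> \<in> space M. f (V \<omega>) \<in> S} * emeasure M {\<omega> \<in> space M. g (U \<omega>) \<in> D}"
    by simp
qed

text \<open>Null sets change neither the law of \<open>U\<close> nor the joint law with
  \<open>V\<close>. This is what carries independence over to \<open>W\<close>, which agrees with
  explicit functions of the coefficients only almost surely.\<close>

lemma indep_rv_cong_AE:
  assumes ind: "indep_rv N V K U" and U': "U' \<in> measurable M K" and eq: "AE \<omega> in M. U \<omega> = U' \<omega>"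
  shows "indep_rv N V K U'"
proof -
  note [measurable] = indep_rvD(1,2)[OF ind] U'
  have "emeasure M {\<omega> \<in> space M. U \<omega> \<in> D} = emeasure M {\<omega> \<in> space M. U' \<omega> \<in> D}"
    and "emeasure M {\<omega> \<in> space M. V \<omega> \<in> S \<and> U \<omega> \<in> D} = emeasure M {\<omega> \<in> space M. V \<omega> \<in> S \<and> U' \<omega> \<in> D}"
    if [measurable]: "S \<in> sets N" "D \<in> sets K" for S D
    by (rule emeasure_eq_AE; use eq in auto)+
  then show ?thesis
    using ind U' unfolding indep_rv_def by simp
qed

lemma indep_rv_distr:
  assumes ind: "indep_rv N V K U"
  shows "distr M N V \<Otimes>\<^sub>M distr M K U = distr M (N \<Otimes>\<^sub>M K) (\<lambda>\<omega>. (V \<omega>, U \<omega>))"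
proof -
  note [measurable] = indep_rvD(1,2)[OF ind]
  interpret V: prob_space "distr M N V" by (rule prob_space_distr) simp
  interpret U: prob_space "distr M K U" by (rule prob_space_distr) simp
  show ?thesis
  proof (rule pair_measure_eqI)
    fix S D assume "S \<in> sets (distr M N V)" "D \<in> sets (distr M K U)"
    then have S[measurable]: "S \<in> sets N" and D[measurable]: "D \<in> sets K" by auto
    have "emeasure (distr M (N \<Otimes>\<^sub>M K) (\<lambda>\<omega>. (V \<omega>, U \<omega>))) (S \<times> D)
        = emeasure M {\<omega> \<in> space M. V \<omega> \<in> S \<and> U \<omega> \<in> D}"
      by (subst emeasure_distr) (auto intro!: arg_cong[where f="emeasure M"])
    moreover have "emeasure (distr M N V) S = emeasure M {\<omega> \<in> space M. V \<omega> \<in> S}"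
      by (subst emeasure_distr) (auto intro!: arg_cong[where f="emeasure M"])
    moreover have "emeasure (distr M K U) D = emeasure M {\<omega> \<in> space M. U \<omega> \<in> D}"
      by (subst emeasure_distr) (auto intro!: arg_cong[where f="emeasure M"])
    ultimately show "emeasure (distr M N V) S * emeasure (distr M K U) D =
        emeasure (distr M (N \<Otimes>\<^sub>M K) (\<lambda>\<omega>. (V \<omega>, U \<omega>))) (S \<times> D)"
      using indep_rvD(3)[OF ind S D] by simp
  qed (simp_all add: V.sigma_finite_measure_axioms U.sigma_finite_measure_axioms)
qed

text \<open>Fubini over the law of \<open>P\<close>: for fixed \<open>p\<close> the event concerns
  \<open>E\<close> alone, where \<open>v\<close> and \<open>r\<close> are independent, so the factor
  for \<open>v\<close> comes out of the integral. It combines independence across times with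
  independence of the rows within one time.\<close>

lemma indep_rv_triple:
  assumes ind: "indep_rv S P T E" and ind': "indep_rv N (\<lambda>\<omega>. v (E \<omega>)) L (\<lambda>\<omega>. r (E \<omega>))"
    and [measurable]: "v \<in> measurable T N" "r \<in> measurable T L"
  shows "indep_rv N (\<lambda>\<omega>. v (E \<omega>)) (S \<Otimes>\<^sub>M L) (\<lambda>\<omega>. (P \<omega>, r (E \<omega>)))"
  unfolding indep_rv_def
proof (intro conjI ballI)
  note PE[measurable] = indep_rvD(1,2)[OF ind]
  interpret P: prob_space "distr M S P" by (rule prob_space_distr) simp
  interpret E: prob_space "distr M T E" by (rule prob_space_distr) simp
  show "(\<lambda>\<omega>. v (E \<omega>)) \<in> measurable M N" "(\<lambda>\<omega>. (P \<omega>, r (E \<omega>))) \<in> measurable M (S \<Otimes>\<^sub>M L)"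
    by measurable
  fix B D assume B[measurable]: "B \<in> sets N" and D[measurable]: "D \<in> sets (S \<Otimes>\<^sub>M L)"
  have slice: "emeasure (distr M T E) (Pair p -` {x \<in> space (S \<Otimes>\<^sub>M T). v (snd x) \<in> C \<and> (fst x, r (snd x)) \<in> D}) =
      emeasure M {\<omega> \<in> space M. v (E \<omega>) \<in> C \<and> r (E \<omega>) \<in> Pair p -` D}"
    if [measurable]: "C \<in> sets N" and p: "p \<in> space S" for C p
  proof -
    have "Pair p -` {x \<in> space (S \<Otimes>\<^sub>M T). v (snd x) \<in> C \<and> (fst x, r (snd x)) \<in> D} \<in> sets T"
      by (rule sets_Pair1[of _ S]) measurable
    then show ?thesis
      by (subst emeasure_distr)
        (use p in \<open>auto intro!: arg_cong[where f="emeasure M"] simp: space_pair_measure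
          dest: measurable_space[OF PE(2)]\<close>)
  qed
  have split: "emeasure M {\<omega> \<in> space M. v (E \<omega>) \<in> C \<and> (P \<omega>, r (E \<omega>)) \<in> D} =
      (\<integral>\<^sup>+p. emeasure M {\<omega> \<in> space M. v (E \<omega>) \<in> C \<and> r (E \<omega>) \<in> Pair p -` D} \<partial>distr M S P)"
    if C[measurable]: "C \<in> sets N" for C
  proof -
    let ?Q = "{x \<in> space (S \<Otimes>\<^sub>M T). v (snd x) \<in> C \<and> (fst x, r (snd x)) \<in> D}"
    have Q[measurable]: "?Q \<in> sets (S \<Otimes>\<^sub>M T)" by measurable
    have "emeasure M {\<omega> \<in> space M. v (E \<omega>) \<in> C \<and> (P \<omega>, r (E \<omega>)) \<in> D} =
        emeasure (distr M (S \<Otimes>\<^sub>M T) (\<lambda>\<omega>. (P \<omega>, E \<omega>))) ?Q"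
      by (subst emeasure_distr)
        (auto intro!: arg_cong[where f="emeasure M"] simp: space_pair_measure
          dest: measurable_space[OF PE(1)] measurable_space[OF PE(2)])
    also have "\<dots> = (\<integral>\<^sup>+p. emeasure (distr M T E) (Pair p -` ?Q) \<partial>distr M S P)"
      unfolding indep_rv_distr[OF ind, symmetric] by (rule E.emeasure_pair_measure_alt) (use Q in simp)
    also have "\<dots> = (\<integral>\<^sup>+p. emeasure M {\<omega> \<in> space M. v (E \<omega>) \<in> C \<and> r (E \<omega>) \<in> Pair p -` D} \<partial>distr M S P)"
      by (intro nn_integral_cong slice C) simp
    finally show ?thesis .
  qed
  \<comment> \<open>With \<open>C = space N\<close> the condition on \<open>v\<close> is vacuous, so
    \<open>slice\<close> and \<open>split\<close> also describe the law of the pair without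
    \<open>v\<close>.\<close>
  have full: "v (E \<omega>) \<in> space N" if "\<omega> \<in> space M" for \<omega>
    using measurable_space[OF indep_rvD(1)[OF ind'] that] .
  have fullP: "{\<omega> \<in> space M. v (E \<omega>) \<in> space N \<and> (P \<omega>, r (E \<omega>)) \<in> D} = {\<omega> \<in> space M. (P \<omega>, r (E \<omega>)) \<in> D}"
    using full by auto
  have prodp: "emeasure M {\<omega> \<in> space M. v (E \<omega>) \<in> B \<and> r (E \<omega>) \<in> Pair p -` D} =
      emeasure M {\<omega> \<in> space M. v (E \<omega>) \<in> B} * emeasure M {\<omega> \<in> space M. v (E \<omega>) \<in> space N \<and> r (E \<omega>) \<in> Pair p -` D}" for p
    using indep_rvD(3)[OF ind' B sets_Pair1[OF D]] full by (simp cong: conj_cong)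
  have "emeasure M {\<omega> \<in> space M. v (E \<omega>) \<in> B \<and> (P \<omega>, r (E \<omega>)) \<in> D} =
     (\<integral>\<^sup>+p. emeasure M {\<omega> \<in> space M. v (E \<omega>) \<in> B} *
        emeasure M {\<omega> \<in> space M. v (E \<omega>) \<in> space N \<and> r (E \<omega>) \<in> Pair p -` D} \<partial>distr M S P)"
    unfolding split[OF B] by (intro nn_integral_cong prodp)
  also have "\<dots> = emeasure M {\<omega> \<in> space M. v (E \<omega>) \<in> B} *
     (\<integral>\<^sup>+p. emeasure M {\<omega> \<in> space M. v (E \<omega>) \<in> space N \<and> r (E \<omega>) \<in> Pair p -` D} \<partial>distr M S P)"
  proof (rule nn_integral_cmult)
    have "(\<lambda>p. emeasure (distr M T E) (Pair p -` {x \<in> space (S \<Otimes>\<^sub>M T). v (snd x) \<in> space N \<and> (fst x, r (snd x)) \<in> D}))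
        \<in> borel_measurable S"
      by (rule E.measurable_emeasure_Pair[of _ S]) measurable
    then show "(\<lambda>p. emeasure M {\<omega> \<in> space M. v (E \<omega>) \<in> space N \<and> r (E \<omega>) \<in> Pair p -` D})
        \<in> borel_measurable (distr M S P)"
      using slice[of "space N"] by (simp cong: measurable_cong)
  qed
  also have "(\<integral>\<^sup>+p. emeasure M {\<omega> \<in> space M. v (E \<omega>) \<in> space N \<and> r (E \<omega>) \<in> Pair p -` D} \<partial>distr M S P) =
      emeasure M {\<omega> \<in> space M. (P \<omega>, r (E \<omega>)) \<in> D}"
    using split[of "space N"] fullP by simp
  finally show "emeasure M {\<omega> \<in> space M. v (E \<omega>) \<in> B \<and> (P \<omega>, r (E \<omega>)) \<in> D} =
      emeasure M {\<omega> \<in> space M. v (E \<omega>) \<in> B} * emeasure M {\<omega> \<in> space M. (P \<omega>, r (E \<omega>)) \<in> D}" .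
qed

text \<open>Freezing lemma followed by the tower property: given \<open>U\<close>, the variable
  \<open>V\<close> is integrated out. Since \<open>G\<close> may be strictly coarser than the
  sigma-algebra of \<open>U\<close>, the result need not be \<open>G\<close>-measurable and stays
  inside a conditional expectation.\<close>

lemma cond_exp_indep_rv:
  fixes \<phi> :: "'b \<times> 'c \<Rightarrow> real"
  assumes ind: "indep_rv N V K U" and \<phi>[measurable]: "\<phi> \<in> borel_measurable (N \<Otimes>\<^sub>M K)"
    and bound: "\<And>x. \<bar>\<phi> x\<bar> \<le> c"
    and GM: "subalgebra M G" and G: "sets G \<subseteq> sets (vimage_algebra (space M) U K)"
  shows "AE \<omega> in M. real_cond_exp M G (\<lambda>\<omega>. \<phi> (V \<omega>, U \<omega>)) \<omega> =
           real_cond_exp M G (\<lambda>\<omega>. \<integral>\<omega>'. \<phi> (V \<omega>', U \<omega>) \<partial>M) \<omega>"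
proof -
  note [measurable] = indep_rvD(1,2)[OF ind]
  interpret finite_measure_subalgebra M G by unfold_locales (rule GM)
  interpret V: prob_space "distr M N V" by (rule prob_space_distr) simp
  interpret U: prob_space "distr M K U" by (rule prob_space_distr) simp
  interpret VU: pair_prob_space "distr M N V" "distr M K U" ..
  define \<psi> where "\<psi> u = (\<integral>v. \<phi> (v, u) \<partial>distr M N V)" for u
  have [measurable]: "\<psi> \<in> borel_measurable K"
    unfolding \<psi>_def by (rule V.borel_measurable_lebesgue_integral) (simp add: measurable_split_conv)
  have \<psi>: "(\<integral>\<omega>'. \<phi> (V \<omega>', U \<omega>) \<partial>M) = \<psi> (U \<omega>)" if "\<omega> \<in> space M" for \<omega>
    unfolding \<psi>_def using measurable_space[OF indep_rvD(2)[OF ind] that]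
    by (subst integral_distr) auto
  have \<psi>_bound: "\<bar>\<psi> u\<bar> \<le> c" if [measurable]: "u \<in> space K" for u
  proof -
    have "integrable (distr M N V) (\<lambda>v. \<phi> (v, u))"
      by (rule V.integrable_const_bound[where B=c]) (use bound in auto)
    then have "\<bar>\<psi> u\<bar> \<le> (\<integral>v. c \<partial>distr M N V)"
      unfolding \<psi>_def real_norm_def[symmetric] using bound
      by (intro integral_norm_bound[THEN order_trans] integral_mono) auto
    then show ?thesis using V.prob_space by simp
  qed
  have int\<psi>: "integrable M (\<lambda>\<omega>. \<psi> (U \<omega>))"
    by (rule integrable_const_bound[where B=c])
      (use \<psi>_bound measurable_space[OF indep_rvD(2)[OF ind]] in auto)
  have "AE \<omega> in M. real_cond_exp M G (\<lambda>\<omega>. \<phi> (V \<omega>, U \<omega>)) \<omega> = real_cond_exp M G (\<lambda>\<omega>. \<psi> (U \<omega>)) \<omega>"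
  proof (rule real_cond_exp_charact)
    show "integrable M (\<lambda>\<omega>. \<phi> (V \<omega>, U \<omega>))"
      by (rule integrable_const_bound[where B=c]) (use bound in auto)
    show "integrable M (real_cond_exp M G (\<lambda>\<omega>. \<psi> (U \<omega>)))"
      by (rule real_cond_exp_int(1)[OF int\<psi>])
    \<comment> \<open>A set of \<open>G\<close> is the preimage under \<open>U\<close> of some
      \<open>D'\<close>, so its indicator is a function of \<open>U\<close> and Fubini for the
      product law can integrate over \<open>V\<close> first.\<close>
    fix D assume D: "D \<in> sets G"
    then obtain D' where D'[measurable]: "D' \<in> sets K" and DD': "D = U -` D' \<inter> space M"
      using G measurable_space[OF indep_rvD(2)[OF ind]] by (auto simp: sets_vimage_algebra2 subset_iff)
    have ind_eq: "indicator D \<omega> = (indicator D' (U \<omega>) :: real)" if "\<omega> \<in> space M" for \<omega>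
      using that DD' by (auto simp: indicator_def)
    have "(\<integral>\<omega>\<in>D. \<phi> (V \<omega>, U \<omega>) \<partial>M) = (\<integral>\<omega>. indicator D' (U \<omega>) * \<phi> (V \<omega>, U \<omega>) \<partial>M)"
      unfolding set_lebesgue_integral_def by (rule Bochner_Integration.integral_cong) (auto simp: ind_eq)
    also have "\<dots> = (\<integral>x. indicator D' (snd x) * \<phi> x \<partial>distr M (N \<Otimes>\<^sub>M K) (\<lambda>\<omega>. (V \<omega>, U \<omega>)))"
      by (subst integral_distr) auto
    also have "\<dots> = (\<integral>x. indicator D' (snd x) * \<phi> x \<partial>(distr M N V \<Otimes>\<^sub>M distr M K U))"
      by (simp add: indep_rv_distr[OF ind])
    also have "\<dots> = (\<integral>u. (\<integral>v. indicator D' (snd (v, u)) * \<phi> (v, u) \<partial>distr M N V) \<partial>distr M K U)"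
    proof -
      have "integrable (distr M N V \<Otimes>\<^sub>M distr M K U) (\<lambda>x. indicator D' (snd x) * \<phi> x)"
        by (rule VU.P.integrable_const_bound[where B=c])
          (use bound in \<open>auto simp: indicator_def intro: order_trans[OF abs_ge_zero bound]\<close>)
      then show ?thesis
        by (subst VU.integral_snd) (auto simp: case_prod_beta')
    qed
    also have "\<dots> = (\<integral>u. indicator D' u * \<psi> u \<partial>distr M K U)"
      by (simp add: \<psi>_def)
    also have "\<dots> = (\<integral>\<omega>. indicator D' (U \<omega>) * \<psi> (U \<omega>) \<partial>M)"
      by (subst integral_distr) auto
    also have "\<dots> = (\<integral>\<omega>\<in>D. \<psi> (U \<omega>) \<partial>M)"
      unfolding set_lebesgue_integral_def by (rule Bochner_Integration.integral_cong) (auto simp: ind_eq)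
    also have "\<dots> = (\<integral>\<omega>\<in>D. real_cond_exp M G (\<lambda>\<omega>. \<psi> (U \<omega>)) \<omega> \<partial>M)"
      by (rule real_cond_exp_intA[OF int\<psi> D])
    finally show "(\<integral>\<omega>\<in>D. \<phi> (V \<omega>, U \<omega>) \<partial>M) = (\<integral>\<omega>\<in>D. real_cond_exp M G (\<lambda>\<omega>. \<psi> (U \<omega>)) \<omega> \<partial>M)" .
  qed simp
  moreover have "AE \<omega> in M. real_cond_exp M G (\<lambda>\<omega>. \<psi> (U \<omega>)) \<omega> =
      real_cond_exp M G (\<lambda>\<omega>. \<integral>\<omega>'. \<phi> (V \<omega>', U \<omega>) \<partial>M) \<omega>"
  proof (rule real_cond_exp_cong)
    show "(\<lambda>\<omega>. \<integral>\<omega>'. \<phi> (V \<omega>', U \<omega>) \<partial>M) \<in> borel_measurable M"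
      by (subst measurable_cong[OF \<psi>]) auto
  qed (use \<psi> in auto)
  ultimately show ?thesis by eventually_elim simp
qed

end

section \<open>Measurability and limits along sequences\<close>

lemma borel_measurable_vec_nth [measurable (raw)]:
  fixes f :: "'a \<Rightarrow> ('b::real_normed_vector)^'n"
  assumes "f \<in> borel_measurable M"
  shows "(\<lambda>x. f x $ i) \<in> borel_measurable M"
  using assms by (rule measurable_compose) (intro borel_measurable_continuous_onI continuous_intros)

lemma borel_measurable_vec_iff:
  fixes f :: "'a \<Rightarrow> ('b::euclidean_space)^'n"
  shows "f \<in> borel_measurable M \<longleftrightarrow> (\<forall>i. (\<lambda>x. f x $ i) \<in> borel_measurable M)"
proof
  assume "\<forall>i. (\<lambda>x. f x $ i) \<in> borel_measurable M"
  then show "f \<in> borel_measurable M"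
    by (subst borel_measurable_euclidean_space) (auto simp: Basis_vec_def inner_axis intro!: borel_measurable_inner)
qed simp

lemma borel_measurable_matrix_matrix_mult [measurable (raw)]:
  fixes f :: "'a \<Rightarrow> real^'n^'m" and g :: "'a \<Rightarrow> real^'k^'n"
  assumes [measurable]: "f \<in> borel_measurable M" "g \<in> borel_measurable M"
  shows "(\<lambda>x. f x ** g x) \<in> borel_measurable M"
  unfolding borel_measurable_vec_iff matrix_matrix_mult_def by simp

lemma borel_measurable_matrix_vector_mult [measurable (raw)]:
  fixes f :: "'a \<Rightarrow> real^'n^'m" and g :: "'a \<Rightarrow> real^'n"
  assumes [measurable]: "f \<in> borel_measurable M" "g \<in> borel_measurable M"
  shows "(\<lambda>x. f x *v g x) \<in> borel_measurable M"
  unfolding borel_measurable_vec_iff matrix_vector_mult_def by simp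

text \<open>The product runs backwards from \<open>s\<close>, so only factors with index at most
  \<open>s\<close> have to be measurable. On a product space indexed by \<open>{..u}\<close> these
  are available whenever \<open>s \<le> u\<close>.\<close>

lemma borel_measurable_back_prod [measurable]:
  assumes [measurable]: "\<And>r. r \<le> s \<Longrightarrow> (\<lambda>x. a x r) \<in> borel_measurable M"
  shows "(\<lambda>x. back_prod (a x) s i) \<in> borel_measurable M"
  by (induction i) auto

text \<open>Along a sequence only countably many thresholds occur, so outside a single null set the
  chosen versions may be replaced by \<open>R\<close> itself.\<close>

lemma as_limit_sequence:
  assumes "as_limit M R L" and u: "filterlim u at_top sequentially"
  shows "AE \<omega> in M. (\<lambda>n. R (u n) \<omega>) \<longlonglongrightarrow> L \<omega>"
proof -
  obtain S where S: "versions M R S" "AE \<omega> in M. ((\<lambda>v. S v \<omega>) \<longlongrightarrow> L \<omega>) at_top"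
    using assms(1) unfolding as_limit_def by blast
  have "AE \<omega> in M. \<forall>n. S (u n) \<omega> = R (u n) \<omega>"
    using S(1) unfolding versions_def AE_all_countable by blast
  with S(2) show ?thesis
  proof eventually_elim
    case (elim \<omega>)
    then show ?case
      using filterlim_compose[OF elim(1) u] by simp
  qed
qed

lemma as_limsup_finite_sequence:
  assumes "as_limsup_finite M R" and u: "filterlim u at_top sequentially"
  shows "AE \<omega> in M. \<exists>C. \<forall>\<^sub>F n in sequentially. R (u n) \<omega> \<le> C"
proof -
  obtain S where S: "versions M R S" "AE \<omega> in M. Limsup at_top (\<lambda>v. ereal (S v \<omega>)) < \<infinity>"
    using assms(1) unfolding as_limsup_finite_def by blast
  have "AE \<omega> in M. \<forall>n. S (u n) \<omega> = R (u n) \<omega>"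
    using S(1) unfolding versions_def AE_all_countable by blast
  with S(2) show ?thesis
  proof eventually_elim
    case (elim \<omega>)
    \<comment> \<open>A level strictly between the limsup and infinity is a real number, and it
      eventually bounds the values.\<close>
    obtain c where c: "Limsup at_top (\<lambda>v. ereal (S v \<omega>)) < c" "c < \<infinity>"
      using dense[OF elim(1)] by blast
    have "\<forall>\<^sub>F v in at_top. ereal (S v \<omega>) < c"
      using c(1) by (rule Limsup_lessD)
    then have "\<forall>\<^sub>F v in at_top. S v \<omega> \<le> real_of_ereal c"
      by (rule eventually_mono) (use c(2) in \<open>cases c; auto\<close>)
    then have "\<forall>\<^sub>F n in sequentially. S (u n) \<omega> \<le> real_of_ereal c"
      using u by (rule eventually_compose_filterlim)
    then show ?case
      using elim(2) by auto
  qed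
qed

lemma filterlim_power2_at_top: "filterlim (\<lambda>n. 2 ^ n :: real) at_top sequentially"
  by (rule filterlim_at_infinity_imp_filterlim_at_top[OF filterlim_realpow_sequentially_gt1]) auto

section \<open>Tails under Grey's assumption\<close>

text \<open>The tail divided by \<open>?R\<close> has the same positive limit \<open>p\<close> at
  \<open>x\<close> and at \<open>2 * x\<close>, so the tail ratio behaves like
  \<open>?R (2 * x) / ?R x\<close>, which tends to \<open>2 powr - \<alpha>\<close> by slow
  variation.\<close>

lemma grey_tail_ratio:
  assumes "grey M \<alpha> A B"
  shows "\<forall>\<^sub>F x in at_top. measure M {\<omega> \<in> space M. B \<omega> > x} > 0"
    "((\<lambda>x. measure M {\<omega> \<in> space M. B \<omega> > 2 * x} / measure M {\<omega> \<in> space M. B \<omega> > x}) \<longlongrightarrow> 2 powr - \<alpha>) at_top"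
proof -
  obtain p l where p0: "p \<ge> 0" "p \<noteq> 0" and l: "slowly_varying l"
    and lim: "((\<lambda>x. measure M {\<omega> \<in> space M. B \<omega> > x} / (x powr (- \<alpha>) * l x)) \<longlongrightarrow> p) at_top"
    using assms unfolding grey_def by blast
  from p0 have p: "p > 0" by simp
  let ?T = "\<lambda>x. measure M {\<omega> \<in> space M. B \<omega> > x}" and ?R = "\<lambda>x. x powr (- \<alpha>) * l x"
  have pos: "\<forall>\<^sub>F x in at_top. ?T x / ?R x > 0"
    using order_tendstoD(1)[OF lim p] .
  \<comment> \<open>A positive quotient has a nonzero numerator, and a probability that is nonzero
    is positive.\<close>
  then show *: "\<forall>\<^sub>F x in at_top. ?T x > 0"
    by (rule eventually_mono) (metis divide_eq_0_iff less_irrefl measure_nonneg order_less_le)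
  have two: "filterlim (\<lambda>x::real. 2 * x) at_top at_top"
    by (rule filterlim_tendsto_pos_mult_at_top[OF tendsto_const]) (auto simp: filterlim_ident)
  have lim2: "((\<lambda>x. ?T (2 * x) / ?R (2 * x)) \<longlongrightarrow> p) at_top"
    using filterlim_compose[OF lim two] .
  have l2: "((\<lambda>x. l (2 * x) / l x) \<longlongrightarrow> 1) at_top"
    by (rule l[unfolded slowly_varying_def, rule_format]) simp
  have "((\<lambda>x. (?T (2 * x) / ?R (2 * x)) / (?T x / ?R x) * (2 powr - \<alpha> * (l (2 * x) / l x))) \<longlongrightarrow> p / p * (2 powr - \<alpha> * 1)) at_top"
    using p by (intro tendsto_intros lim lim2 l2) auto
  then have "((\<lambda>x. (?T (2 * x) / ?R (2 * x)) / (?T x / ?R x) * (2 powr - \<alpha> * (l (2 * x) / l x))) \<longlongrightarrow> 2 powr - \<alpha>) at_top"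
    using p by simp
  moreover have "\<forall>\<^sub>F x in at_top. (?T (2 * x) / ?R (2 * x)) / (?T x / ?R x) * (2 powr - \<alpha> * (l (2 * x) / l x)) = ?T (2 * x) / ?T x"
    using pos eventually_compose_filterlim[OF pos two] eventually_gt_at_top[of 0]
  proof eventually_elim
    case (elim x)
    then have "?T x \<noteq> 0" "l x \<noteq> 0" "l (2 * x) \<noteq> 0" "x powr - \<alpha> \<noteq> 0"
      by auto
    then show ?case
      using \<open>x > 0\<close> by (simp add: powr_mult field_simps)
  qed
  ultimately show "((\<lambda>x. ?T (2 * x) / ?T x) \<longlongrightarrow> 2 powr - \<alpha>) at_top"
    by (rule Lim_transform_eventually)
qed

text \<open>The moment of order \<open>\<alpha> + \<nu>\<close> gives by Markov's inequality a bound
  of order \<open>?b ^ n\<close>, whereas the tail of \<open>B\<close> at \<open>2 ^ n\<close> loses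
  asymptotically only the factor \<open>2 powr - \<alpha>\<close> per step.\<close>

lemma (in prob_space) grey_coefficient_negligible:
  assumes gr: "grey M \<alpha> A B" and [measurable]: "random_variable borel A" and \<delta>: "\<delta> > 0"
  shows "(\<lambda>n. prob {\<omega> \<in> space M. \<bar>A \<omega>\<bar> \<ge> \<delta> * 2 ^ n} / prob {\<omega> \<in> space M. B \<omega> > 2 ^ n}) \<longlonglongrightarrow> 0"
proof -
  obtain \<nu> where \<nu>: "\<nu> > 0" and fin: "(\<integral>\<^sup>+\<omega>. ennreal (\<bar>A \<omega>\<bar> powr (\<alpha> + \<nu>)) \<partial>M) < \<infinity>" and \<alpha>: "\<alpha> > 0"
    using gr unfolding grey_def by blast
  let ?T = "\<lambda>n::nat. prob {\<omega> \<in> space M. B \<omega> > 2 ^ n}" and ?b = "2 powr - (\<alpha> + \<nu>) :: real"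
  define K where "K = (\<integral>\<omega>. \<bar>A \<omega>\<bar> powr (\<alpha> + \<nu>) \<partial>M)"
  have int: "integrable M (\<lambda>\<omega>. \<bar>A \<omega>\<bar> powr (\<alpha> + \<nu>))"
    by (rule integrableI_nonneg) (use fin in auto)
  have markov: "prob {\<omega> \<in> space M. \<bar>A \<omega>\<bar> \<ge> \<delta> * 2 ^ n} \<le> K / \<delta> powr (\<alpha> + \<nu>) * ?b ^ n" for n
  proof -
    have "(2 ^ n) powr (\<alpha> + \<nu>) = (2 powr (\<alpha> + \<nu>)) ^ n"
      by (simp add: powr_realpow[symmetric] powr_powr mult.commute)
    then have eq: "K / (\<delta> * 2 ^ n) powr (\<alpha> + \<nu>) = K / \<delta> powr (\<alpha> + \<nu>) * ?b ^ n"
      using \<delta> unfolding powr_minus_divide[of 2 "\<alpha> + \<nu>"] by (simp add: powr_mult power_divide)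
    have "{\<omega> \<in> space M. \<bar>A \<omega>\<bar> \<ge> \<delta> * 2 ^ n} = {\<omega> \<in> space M. \<bar>A \<omega>\<bar> powr (\<alpha> + \<nu>) \<ge> (\<delta> * 2 ^ n) powr (\<alpha> + \<nu>)}"
      using \<delta> \<alpha> \<nu> powr_mono2[of "\<alpha> + \<nu>" "\<delta> * 2 ^ n"]
        powr_less_mono2[of "\<alpha> + \<nu>" "\<bar>_\<bar>" "\<delta> * 2 ^ n"]
      by (intro Collect_cong conj_cong refl) (smt (verit) abs_ge_zero zero_less_mult_iff zero_less_power)
    moreover have "prob {\<omega> \<in> space M. \<bar>A \<omega>\<bar> powr (\<alpha> + \<nu>) \<ge> (\<delta> * 2 ^ n) powr (\<alpha> + \<nu>)}
        \<le> K / (\<delta> * 2 ^ n) powr (\<alpha> + \<nu>)"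
      unfolding K_def by (rule integral_Markov_inequality_measure[OF int, of "{}"]) (use \<delta> in auto)
    ultimately show ?thesis
      unfolding eq by simp
  qed
  \<comment> \<open>The Markov bound relative to the tail, up to a constant. Summability of
    \<open>r\<close> is more than enough for convergence to 0.\<close>
  define r where "r n = ?b ^ n / ?T n" for n
  have T: "\<forall>\<^sub>F n in sequentially. ?T n > 0"
    using eventually_compose_filterlim[OF grey_tail_ratio(1)[OF gr] filterlim_power2_at_top] .
  have q: "(\<lambda>n. ?T (Suc n) / ?T n) \<longlonglongrightarrow> 2 powr - \<alpha>"
    using filterlim_compose[OF grey_tail_ratio(2)[OF gr] filterlim_power2_at_top] by simp
  \<comment> \<open>Half of \<open>\<nu>\<close> absorbs the error in the limit of the tail ratio;
    the other half leaves the contraction factor \<open>2 powr (- \<nu> / 2)\<close> for the ratio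
    test.\<close>
  have "2 powr - (\<alpha> + \<nu> / 2) < (2 powr - \<alpha> :: real)"
    using \<nu> by simp
  then have q': "\<forall>\<^sub>F n in sequentially. ?T (Suc n) / ?T n > 2 powr - (\<alpha> + \<nu> / 2)"
    using order_tendstoD(1)[OF q] by blast
  obtain N where N: "?T n > 0" "?T (Suc n) / ?T n > 2 powr - (\<alpha> + \<nu> / 2)" if "n \<ge> N" for n
    using eventually_conj[OF T q'] unfolding eventually_sequentially by blast
  have "summable r"
  proof (rule summable_ratio_test)
    show "2 powr (- \<nu> / 2) < (1::real)" using \<nu> by (simp add: powr_less_one)
    fix n assume n: "n \<ge> N"
    have le: "?T (Suc n) \<ge> 2 powr - (\<alpha> + \<nu> / 2) * ?T n"
      using N[OF n] by (simp add: pos_less_divide_eq)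
    have e: "2 powr - (\<alpha> + \<nu> / 2) * 2 powr (- \<nu> / 2) = ?b"
      unfolding powr_add[symmetric] by (rule arg_cong[where f="(powr) 2"]) (simp add: field_simps)
    have "?b * ?T n = 2 powr (- \<nu> / 2) * (2 powr - (\<alpha> + \<nu> / 2) * ?T n)"
      unfolding e[symmetric] by (simp only: mult_ac)
    also have "\<dots> \<le> 2 powr (- \<nu> / 2) * ?T (Suc n)"
      by (rule mult_left_mono[OF le]) simp
    finally have "?b ^ n * (?b * ?T n) \<le> ?b ^ n * (2 powr (- \<nu> / 2) * ?T (Suc n))"
      by (rule mult_left_mono) simp
    then show "norm (r (Suc n)) \<le> 2 powr (- \<nu> / 2) * norm (r n)"
      using N(1)[of n] N(1)[of "Suc n"] n unfolding r_def by (simp add: field_simps)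
  qed
  then have "(\<lambda>n. K / \<delta> powr (\<alpha> + \<nu>) * r n) \<longlonglongrightarrow> K / \<delta> powr (\<alpha> + \<nu>) * 0"
    by (intro tendsto_intros summable_LIMSEQ_zero)
  then have lim: "(\<lambda>n. K / \<delta> powr (\<alpha> + \<nu>) * r n) \<longlonglongrightarrow> 0" by simp
  have "prob {\<omega> \<in> space M. \<bar>A \<omega>\<bar> \<ge> \<delta> * 2 ^ n} / ?T n \<le> K / \<delta> powr (\<alpha> + \<nu>) * r n" for n
    unfolding r_def times_divide_eq_right by (intro divide_right_mono markov) simp
  then show ?thesis
    by (intro tendsto_sandwich[OF _ _ tendsto_const lim] always_eventually allI) (simp_all add: zero_le_divide_iff)
qed

text \<open>If \<open>b\<close> exceeds \<open>2 ^ Suc n\<close>, then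
  \<open>a \<bullet> w + b\<close> exceeds \<open>2 ^ n\<close> unless some entry of
  \<open>a\<close> is of order \<open>2 ^ n\<close>, which is negligible against the tail of
  \<open>b\<close>. The constant \<open>c\<close> does not depend on \<open>K\<close>; only the
  index from which the bound holds does.\<close>

lemma (in prob_space) grey_tail_lower_bound:
  fixes a :: "'a \<Rightarrow> real^3" and b :: "'a \<Rightarrow> real"
  assumes gr: "\<And>j. grey M \<alpha> (\<lambda>\<omega>. a \<omega> $ j) b"
    and [measurable]: "random_variable borel a" "random_variable borel b"
  shows "\<exists>c>0. \<forall>K. \<forall>\<^sub>F n in sequentially. prob {\<omega> \<in> space M. b \<omega> > 2 ^ n} > 0 \<and>
    (\<forall>w. norm w \<le> K \<longrightarrow> prob {\<omega> \<in> space M. a \<omega> \<bullet> w + b \<omega> > 2 ^ n} \<ge> c * prob {\<omega> \<in> space M. b \<omega> > 2 ^ n})"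
proof (intro exI conjI allI)
  let ?T = "\<lambda>n::nat. prob {\<omega> \<in> space M. b \<omega> > 2 ^ n}"
  \<comment> \<open>Half of the limiting ratio of the tails at \<open>2 ^ Suc n\<close> and
    \<open>2 ^ n\<close>; any positive number below that limit would serve.\<close>
  define c :: real where "c = 2 powr - \<alpha> / 2"
  show "c > 0" by (simp add: c_def)
  fix K :: real
  \<comment> \<open>Chosen so that three entries below \<open>\<delta> * 2 ^ n\<close> give an inner
    product with \<open>w\<close> of modulus at most \<open>2 ^ n\<close>. The summand 1 keeps the
    denominator positive when \<open>K = 0\<close>.\<close>
  define \<delta> where "\<delta> = 1 / (3 * (\<bar>K\<bar> + 1))"
  have \<delta>: "\<delta> > 0" by (simp add: \<delta>_def)
  let ?E = "\<lambda>j n. prob {\<omega> \<in> space M. \<bar>a \<omega> $ j\<bar> \<ge> \<delta> * 2 ^ n}"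
  have T: "\<forall>\<^sub>F n in sequentially. ?T n > 0"
    using eventually_compose_filterlim[OF grey_tail_ratio(1)[OF gr] filterlim_power2_at_top] .
  have q: "(\<lambda>n. ?T (Suc n) / ?T n) \<longlonglongrightarrow> 2 powr - \<alpha>"
    using filterlim_compose[OF grey_tail_ratio(2)[OF gr] filterlim_power2_at_top] by simp
  have "(\<lambda>n. ?T (Suc n) / ?T n - (\<Sum>j\<in>UNIV. ?E j n / ?T n)) \<longlonglongrightarrow> 2 powr - \<alpha> - (\<Sum>j\<in>(UNIV::3 set). 0)"
    by (intro tendsto_intros q grey_coefficient_negligible[OF gr _ \<delta>]) simp
  then have "(\<lambda>n. ?T (Suc n) / ?T n - (\<Sum>j\<in>UNIV. ?E j n / ?T n)) \<longlonglongrightarrow> 2 powr - \<alpha>" by simp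
  moreover have "c < 2 powr - \<alpha>" by (simp add: c_def)
  ultimately have "\<forall>\<^sub>F n in sequentially. ?T (Suc n) / ?T n - (\<Sum>j\<in>UNIV. ?E j n / ?T n) > c"
    using order_tendstoD(1) by blast
  with T show "\<forall>\<^sub>F n in sequentially. prob {\<omega> \<in> space M. b \<omega> > 2 ^ n} > 0 \<and>
    (\<forall>w. norm w \<le> K \<longrightarrow> prob {\<omega> \<in> space M. a \<omega> \<bullet> w + b \<omega> > 2 ^ n} \<ge> c * prob {\<omega> \<in> space M. b \<omega> > 2 ^ n})"
  proof eventually_elim
    case (elim n)
    have c_le: "c * ?T n \<le> ?T (Suc n) - (\<Sum>j\<in>UNIV. ?E j n)"
      using elim by (simp add: sum_divide_distrib[symmetric] diff_divide_distrib[symmetric] pos_less_divide_eq)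
    have "prob {\<omega> \<in> space M. a \<omega> \<bullet> w + b \<omega> > 2 ^ n} \<ge> c * ?T n" if w: "norm w \<le> K" for w
    proof -
      let ?B = "\<lambda>j. {\<omega> \<in> space M. \<bar>a \<omega> $ j\<bar> \<ge> \<delta> * 2 ^ n}" and ?A = "{\<omega> \<in> space M. a \<omega> \<bullet> w + b \<omega> > 2 ^ n}"
      have "{\<omega> \<in> space M. b \<omega> > 2 ^ Suc n} \<subseteq> ?A \<union> (\<Union>j\<in>UNIV. ?B j)"
      proof
        fix \<omega> assume \<omega>: "\<omega> \<in> {\<omega> \<in> space M. b \<omega> > 2 ^ Suc n}"
        show "\<omega> \<in> ?A \<union> (\<Union>j\<in>UNIV. ?B j)"
        proof (cases "\<exists>j. \<bar>a \<omega> $ j\<bar> \<ge> \<delta> * 2 ^ n")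
          case False
          have K: "K \<ge> 0" using w norm_ge_zero order_trans by blast
          have "norm (a \<omega>) \<le> (\<Sum>j\<in>UNIV. \<bar>a \<omega> $ j\<bar>)" by (rule norm_le_l1_cart)
          also have "\<dots> \<le> (\<Sum>j\<in>(UNIV::3 set). \<delta> * 2 ^ n)"
            using False by (intro sum_mono) (simp add: not_le less_imp_le)
          finally have na: "norm (a \<omega>) \<le> 3 * \<delta> * 2 ^ n" by simp
          have "\<bar>a \<omega> \<bullet> w\<bar> \<le> norm (a \<omega>) * norm w" by (rule Cauchy_Schwarz_ineq2)
          also have "\<dots> \<le> 3 * \<delta> * 2 ^ n * K"
            using na w \<delta> by (intro mult_mono) auto
          also have "\<dots> = 3 * \<delta> * K * 2 ^ n" by simp
          also have "\<dots> \<le> 1 * 2 ^ n"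
            by (rule mult_right_mono) (use K in \<open>auto simp: \<delta>_def\<close>)
          finally have "a \<omega> \<bullet> w \<ge> - (2 ^ n)" by simp
          then show ?thesis using \<omega> by simp
        qed (use \<omega> in auto)
      qed
      then have "?T (Suc n) \<le> prob (?A \<union> (\<Union>j\<in>UNIV. ?B j))"
        by (intro finite_measure_mono) auto
      also have "\<dots> \<le> prob ?A + prob (\<Union>j\<in>UNIV. ?B j)"
        by (rule measure_Un_le) auto
      also have "prob (\<Union>j\<in>UNIV. ?B j) \<le> (\<Sum>j\<in>UNIV. ?E j n)"
        by (rule measure_UNION_le) auto
      finally show ?thesis using c_le by simp
    qed
    then show ?case using elim by simp
  qed
qed

section \<open>The stationary solution as a function of the coefficients\<close>

lemma sets_past_sigma:
  "sets (past_sigma M W I t) = sigma_sets (space M)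
     {(\<lambda>\<omega>. W s \<omega> $ i) -` S \<inter> space M | s i S. s \<le> t \<and> i \<in> I \<and> S \<in> sets borel}"
  unfolding past_sigma_def by (rule sets_measure_of) auto

lemma space_past_sigma [simp]: "space (past_sigma M W I t) = space M"
  unfolding past_sigma_def by (rule space_measure_of) auto

lemma sets_past_sigma_subset:
  assumes "space N = space M" "\<And>s i. s \<le> t \<Longrightarrow> i \<in> I \<Longrightarrow> (\<lambda>\<omega>. W s \<omega> $ i) \<in> borel_measurable N"
  shows "sets (past_sigma M W I t) \<subseteq> sets N"
  unfolding sets_past_sigma assms(1)[symmetric]
  by (rule sets.sigma_sets_subset) (auto intro!: measurable_sets[OF assms(2)])

lemma measurable_past_sigma:
  assumes "s \<le> t" "i \<in> I"
  shows "(\<lambda>\<omega>. W s \<omega> $ i) \<in> borel_measurable (past_sigma M W I t)"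
  by (rule measurableI) (use assms in \<open>auto simp: sets_past_sigma intro!: sigma_sets.Basic\<close>)

text \<open>The series solution as a function of the coefficient path alone, so that its
  measurability turns independence of coefficients into independence from the past of
  \<open>W\<close>. The restriction makes its values elements of the product space over
  \<open>{..u}\<close>.\<close>

definition past_solution :: "int \<Rightarrow> (int \<Rightarrow> (real^3^3) \<times> (real^3)) \<Rightarrow> int \<Rightarrow> real^3" where
  "past_solution u p = restrict (\<lambda>s. \<Sum>i. back_prod (\<lambda>r. fst (p r)) s i *v snd (p (s - int i))) {..u}"

lemma measurable_past_solution:
  "past_solution u \<in> measurable (PiM {..u} (\<lambda>_. borel)) (PiM {..u} (\<lambda>_. borel))"
proof -
  have comp: "(\<lambda>p. p r) \<in> borel_measurable (PiM {..u} (\<lambda>_. borel :: ((real^3^3) \<times> (real^3)) measure))"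
    if "r \<le> u" for r :: int
    using that by (intro measurable_component_singleton) simp
  have [measurable]: "(\<lambda>p. fst (p r)) \<in> borel_measurable (PiM {..u} (\<lambda>_. borel :: ((real^3^3) \<times> (real^3)) measure))"
    "(\<lambda>p. snd (p r)) \<in> borel_measurable (PiM {..u} (\<lambda>_. borel :: ((real^3^3) \<times> (real^3)) measure))"
    if "r \<le> u" for r :: int
    by (rule measurable_compose[OF comp[OF that] borel_measurable_continuous_onI[OF continuous_on_fst[OF continuous_on_id]]]
        measurable_compose[OF comp[OF that] borel_measurable_continuous_onI[OF continuous_on_snd[OF continuous_on_id]]])+
  show ?thesis
    unfolding past_solution_def
    by (intro measurable_restrict borel_measurable_suminf borel_measurable_matrix_vector_mult borel_measurable_back_prod) auto
qed

section \<open>The setting, and independence of new coefficients from the past\<close>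

locale sre = prob_space M for M :: "'w measure" +
  fixes A :: "int \<Rightarrow> 'w \<Rightarrow> real^3^3" and B W :: "int \<Rightarrow> 'w \<Rightarrow> real^3"
    and N :: "real measure" and F :: "real \<Rightarrow> real" and t :: int
  assumes iid: "iid_family M (\<lambda>s \<omega>. (A s \<omega>, B s \<omega>))"
    and W_meas [measurable]: "\<And>s. W s \<in> borel_measurable M"
    and SRE: "\<And>s. AE \<omega> in M. W s \<omega> = A s \<omega> *v W (s - 1) \<omega> + B s \<omega>"
    and W_series: "\<And>s. AE \<omega> in M.
          (\<lambda>i. back_prod (\<lambda>r. A r \<omega>) s i *v B (s - int i) \<omega>) sums W s \<omega>"
    and B2: "\<And>s. indep_vars (\<lambda>_. borel) (\<lambda>i \<omega>. (A s \<omega> $ i, B s \<omega> $ i)) (UNIV :: 3 set)"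
    and B4: "\<And>s i j. prob {\<omega> \<in> space M. A s \<omega> $ i $ j = 0} \<noteq> 1 \<Longrightarrow>
               AE \<omega> in M. A s \<omega> $ i $ j > 0"
    and N: "real_distribution N" and F: "F = cdf N" and F_less: "\<And>x. F x < 1"
begin

sublocale N: real_distribution N by (rule N)

lemma coefficients_measurable [measurable]:
  "A s \<in> borel_measurable M" "B s \<in> borel_measurable M"
proof -
  have AB: "(\<lambda>\<omega>. (A s \<omega>, B s \<omega>)) \<in> borel_measurable M"
    using iid unfolding iid_family_def by (auto simp: indep_vars_def)
  show "A s \<in> borel_measurable M" "B s \<in> borel_measurable M"
    using measurable_compose[OF AB borel_measurable_continuous_onI[OF continuous_on_fst[OF continuous_on_id]]]
      measurable_compose[OF AB borel_measurable_continuous_onI[OF continuous_on_snd[OF continuous_on_id]]]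
    by auto
qed

lemma F_measurable [measurable]: "F \<in> borel_measurable borel"
  unfolding F by (intro borel_measurable_mono monoI N.cdf_nondecreasing)

lemma F_mono: "x \<le> y \<Longrightarrow> F x \<le> F y"
  unfolding F by (rule N.cdf_nondecreasing)

lemma F_nonneg: "0 \<le> F x"
  unfolding F by (rule N.cdf_nonneg)

lemma F_at_top: "(F \<longlongrightarrow> 1) at_top"
  unfolding F by (rule N.cdf_lim_at_top_prob)

abbreviation past_W :: "int \<Rightarrow> 'w \<Rightarrow> int \<Rightarrow> real^3" where
  "past_W u \<omega> \<equiv> restrict (\<lambda>s. W s \<omega>) {..u}"

lemma measurable_past_W [measurable]: "past_W u \<in> measurable M (PiM {..u} (\<lambda>_. borel))"
  by (intro measurable_restrict) simp

text \<open>By the series representation the past of \<open>W\<close> up to \<open>u\<close> is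
  almost surely a function of the coefficients up to \<open>u\<close>, and these are independent of
  the coefficients at the later time \<open>s\<close>.\<close>

lemma indep_past:
  assumes "u < s"
  shows "indep_rv borel (\<lambda>\<omega>. (A s \<omega>, B s \<omega>)) (PiM {..u} (\<lambda>_. borel)) (past_W u)"
proof -
  let ?\<epsilon> = "\<lambda>s \<omega>. (A s \<omega>, B s \<omega>)"
  have "indep_var (PiM {s} (\<lambda>_. borel)) (\<lambda>\<omega>. restrict (\<lambda>i. ?\<epsilon> i \<omega>) {s})
      (PiM {..u} (\<lambda>_. borel)) (\<lambda>\<omega>. restrict (\<lambda>i. ?\<epsilon> i \<omega>) {..u})"
    using iid assms unfolding iid_family_def by (intro indep_var_restrict[where I=UNIV]) auto
  then have "indep_rv (PiM {s} (\<lambda>_. borel)) (\<lambda>\<omega>. restrict (\<lambda>i. ?\<epsilon> i \<omega>) {s})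
      (PiM {..u} (\<lambda>_. borel)) (\<lambda>\<omega>. restrict (\<lambda>i. ?\<epsilon> i \<omega>) {..u})"
    by (rule indep_var_imp_indep_rv)
  then have "indep_rv borel (\<lambda>\<omega>. restrict (\<lambda>i. ?\<epsilon> i \<omega>) {s} s)
      (PiM {..u} (\<lambda>_. borel)) (\<lambda>\<omega>. past_solution u (restrict (\<lambda>i. ?\<epsilon> i \<omega>) {..u}))"
    by (rule indep_rv_compose[where f="\<lambda>p. p s"]) (auto intro: measurable_past_solution)
  then have ind: "indep_rv borel (?\<epsilon> s) (PiM {..u} (\<lambda>_. borel)) (\<lambda>\<omega>. past_solution u (restrict (\<lambda>i. ?\<epsilon> i \<omega>) {..u}))"
    by simp
  \<comment> \<open>The backward product from \<open>r \<le> u\<close> never reads an index above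
    \<open>u\<close>, so restricting the path does no harm.\<close>
  have bp: "back_prod (\<lambda>r. fst (restrict (\<lambda>i. ?\<epsilon> i \<omega>) {..u} r)) r i = back_prod (\<lambda>r. A r \<omega>) r i" if "r \<le> u" for r i \<omega>
    using that by (induction i) auto
  have "AE \<omega> in M. \<forall>s. (\<lambda>i. back_prod (\<lambda>r. A r \<omega>) s i *v B (s - int i) \<omega>) sums W s \<omega>"
    using W_series by (simp add: AE_all_countable)
  then have "AE \<omega> in M. past_solution u (restrict (\<lambda>i. ?\<epsilon> i \<omega>) {..u}) = past_W u \<omega>"
  proof eventually_elim
    case (elim \<omega>)
    show ?case
      unfolding past_solution_def
    proof (rule restrict_ext)
      fix s assume "s \<in> {..u}"
      then show "(\<Sum>i. back_prod (\<lambda>r. fst (restrict (\<lambda>i. ?\<epsilon> i \<omega>) {..u} r)) s i *v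
          snd (restrict (\<lambda>i. ?\<epsilon> i \<omega>) {..u} (s - int i))) = W s \<omega>"
        using elim by (subst bp) (auto simp: sums_iff)
    qed
  qed
  from indep_rv_cong_AE[OF ind _ this] show ?thesis by simp
qed

lemma indep_row_3:
  "indep_rv (borel \<Otimes>\<^sub>M borel) (\<lambda>\<omega>. (A (t + 1) \<omega> $ 3, B (t + 1) \<omega> $ 3)) (PiM {..t} (\<lambda>_. borel)) (past_W t)"
proof -
  have "indep_rv (borel \<Otimes>\<^sub>M borel) (\<lambda>\<omega>. (\<lambda>x. (fst x $ 3, snd x $ 3)) (A (t + 1) \<omega>, B (t + 1) \<omega>))
      (PiM {..t} (\<lambda>_. borel)) (\<lambda>\<omega>. id (past_W t \<omega>))"
    by (rule indep_rv_compose[OF indep_past]) (auto simp: borel_prod intro!: borel_measurable_continuous_onI continuous_intros)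
  then show ?thesis by simp
qed

text \<open>The pasts of \<open>Z\<close> and \<open>Y\<close> up to \<open>t\<close> are functions of this variable, which does not involve
  the coefficients of the equation for \<open>X\<close> at time \<open>t\<close>.\<close>

definition past_ZY :: "'w \<Rightarrow> (int \<Rightarrow> real^3) \<times> (real \<times> real)" where
  "past_ZY \<omega> = (past_W (t - 1) \<omega>, (W t \<omega> $ 1, W t \<omega> $ 3))"

text \<open>Row 2 at time \<open>t\<close> is independent of rows 1 and 3 by (B2), and all three
  rows are independent of the past up to \<open>t - 1\<close>. The values of \<open>Z\<close> and
  \<open>Y\<close> at time \<open>t\<close> are computed from that past and rows 1 and 3.\<close>

lemma indep_row_2:
  "indep_rv (borel \<Otimes>\<^sub>M borel) (\<lambda>\<omega>. (A t \<omega> $ 2, B t \<omega> $ 2))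
     (PiM {..t - 1} (\<lambda>_. borel) \<Otimes>\<^sub>M (borel \<Otimes>\<^sub>M borel)) past_ZY"
proof -
  let ?P = "PiM {..t - 1} (\<lambda>_. borel :: (real^3) measure)" and ?R = "borel \<Otimes>\<^sub>M borel :: ((real^3) \<times> real) measure"
  let ?\<epsilon> = "\<lambda>\<omega>. (A t \<omega>, B t \<omega>)"
  let ?row = "\<lambda>i (x :: (real^3^3) \<times> (real^3)). (fst x $ i, snd x $ i)"
  have row: "?row i \<in> measurable borel ?R" for i
    by (auto simp: borel_prod intro!: borel_measurable_continuous_onI continuous_intros)
  let ?rows = "\<lambda>x. (?row 1 x, ?row 3 x)"
  have rows: "?rows \<in> measurable borel (?R \<Otimes>\<^sub>M ?R)"
    by (rule measurable_Pair[OF row row])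
  have "indep_var (PiM {2} (\<lambda>_. borel)) (\<lambda>\<omega>. restrict (\<lambda>i. ?row i (?\<epsilon> \<omega>)) {2})
      (PiM {1, 3} (\<lambda>_. borel)) (\<lambda>\<omega>. restrict (\<lambda>i. ?row i (?\<epsilon> \<omega>)) {1, 3})"
    using B2[of t] by (intro indep_var_restrict[where I=UNIV]) auto
  then have "indep_rv ?R (\<lambda>\<omega>. restrict (\<lambda>i. ?row i (?\<epsilon> \<omega>)) {2} 2)
      (?R \<Otimes>\<^sub>M ?R) (\<lambda>\<omega>. (\<lambda>p. (p 1, p 3)) (restrict (\<lambda>i. ?row i (?\<epsilon> \<omega>)) {1, 3}))"
    by (rule indep_rv_compose[where f="\<lambda>p. p 2", OF indep_var_imp_indep_rv])
      (auto simp: borel_prod[where 'a="real^3" and 'b=real] intro!: measurable_Pair measurable_component_singleton)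
  then have rows_ind: "indep_rv ?R (\<lambda>\<omega>. ?row 2 (?\<epsilon> \<omega>)) (?R \<Otimes>\<^sub>M ?R) (\<lambda>\<omega>. ?rows (?\<epsilon> \<omega>))"
    by simp
  \<comment> \<open>The equations for \<open>Z\<close> and \<open>Y\<close> applied to the state at
    time \<open>t - 1\<close>: this maps the past together with rows 1 and 3 to
    \<open>past_ZY\<close> almost surely.\<close>
  let ?f = "\<lambda>q :: (int \<Rightarrow> real^3) \<times> (((real^3) \<times> real) \<times> ((real^3) \<times> real)).
    (fst q, (fst (fst (snd q)) \<bullet> fst q (t - 1) + snd (fst (snd q)), fst (snd (snd q)) \<bullet> fst q (t - 1) + snd (snd (snd q))))"
  have [measurable]: "(\<lambda>p. p (t - 1)) \<in> borel_measurable ?P"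
    by (rule measurable_component_singleton) simp
  have f: "?f \<in> measurable (?P \<Otimes>\<^sub>M (?R \<Otimes>\<^sub>M ?R)) (?P \<Otimes>\<^sub>M (borel \<Otimes>\<^sub>M borel))"
    by measurable
  have "indep_rv ?R (\<lambda>\<omega>. ?row 2 (?\<epsilon> \<omega>)) (?P \<Otimes>\<^sub>M (?R \<Otimes>\<^sub>M ?R)) (\<lambda>\<omega>. (past_W (t - 1) \<omega>, ?rows (?\<epsilon> \<omega>)))"
    by (rule indep_rv_triple[OF indep_rv_sym[OF indep_past] rows_ind row rows]) simp
  then have "indep_rv ?R (\<lambda>\<omega>. id (?row 2 (?\<epsilon> \<omega>))) (?P \<Otimes>\<^sub>M (borel \<Otimes>\<^sub>M borel))
      (\<lambda>\<omega>. ?f (past_W (t - 1) \<omega>, ?rows (?\<epsilon> \<omega>)))"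
    by (rule indep_rv_compose[OF _ _ f]) simp
  then have ind: "indep_rv ?R (\<lambda>\<omega>. (A t \<omega> $ 2, B t \<omega> $ 2)) (?P \<Otimes>\<^sub>M (borel \<Otimes>\<^sub>M borel))
      (\<lambda>\<omega>. ?f (past_W (t - 1) \<omega>, ?rows (?\<epsilon> \<omega>)))"
    by simp
  show ?thesis
  proof (rule indep_rv_cong_AE[OF ind])
    show "past_ZY \<in> measurable M (?P \<Otimes>\<^sub>M (borel \<Otimes>\<^sub>M borel))"
      unfolding past_ZY_def by measurable
    show "AE \<omega> in M. ?f (past_W (t - 1) \<omega>, ?rows (?\<epsilon> \<omega>)) = past_ZY \<omega>"
      using SRE[of t] by eventually_elim (simp add: past_ZY_def matrix_vector_mul_component)
  qed
qed

section \<open>The conditioning sigma-algebras\<close>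

abbreviation G :: "3 set \<Rightarrow> 'w measure" where
  "G I \<equiv> past_sigma M W I t"

lemma subalgebra_G: "subalgebra M (G I)"
  unfolding subalgebra_def by (intro conjI sets_past_sigma_subset) simp_all

lemma G_cond_exp: "finite_measure_subalgebra M (G I)"
  by unfold_locales (rule subalgebra_G)

lemma sets_G_subset_past_W: "sets (G I) \<subseteq> sets (vimage_algebra (space M) (past_W t) (PiM {..t} (\<lambda>_. borel)))"
  (is "_ \<subseteq> sets ?V")
proof (rule sets_past_sigma_subset)
  have W: "past_W t \<in> measurable ?V (PiM {..t} (\<lambda>_. borel))"
    by (rule measurable_vimage_algebra1) (intro funcsetI measurable_space[OF measurable_past_W])
  fix s and i :: 3 assume "s \<le> t"
  then have s: "s \<in> {..t}" by simp
  have "(\<lambda>\<omega>. past_W t \<omega> s $ i) \<in> borel_measurable ?V"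
    by (rule borel_measurable_vec_nth[OF measurable_compose[OF W measurable_component_singleton[OF s]]])
  then show "(\<lambda>\<omega>. W s \<omega> $ i) \<in> borel_measurable ?V"
    using s by simp
qed simp

text \<open>At time \<open>t\<close> only the components 1 and 3 are recorded in
  \<open>past_ZY\<close>, hence the restriction on \<open>I\<close>; all earlier states are recorded
  completely. This allows row 2 at time \<open>t\<close> to be integrated out.\<close>

lemma sets_G_subset_past_ZY:
  assumes "2 \<notin> I"
  shows "sets (G I) \<subseteq> sets (vimage_algebra (space M) past_ZY (PiM {..t - 1} (\<lambda>_. borel) \<Otimes>\<^sub>M (borel \<Otimes>\<^sub>M borel)))"
    (is "_ \<subseteq> sets ?V")
proof (rule sets_past_sigma_subset)
  have ZY: "past_ZY \<in> measurable ?V (PiM {..t - 1} (\<lambda>_. borel) \<Otimes>\<^sub>M (borel \<Otimes>\<^sub>M borel))"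
    by (rule measurable_vimage_algebra1) (use measurable_space[OF indep_rvD(2)[OF indep_row_2]] in auto)
  fix s and i :: 3 assume s: "s \<le> t" and i: "i \<in> I"
  show "(\<lambda>\<omega>. W s \<omega> $ i) \<in> borel_measurable ?V"
  proof (cases "s = t")
    case True
    have "(\<lambda>\<omega>. fst (snd (past_ZY \<omega>))) \<in> borel_measurable ?V" "(\<lambda>\<omega>. snd (snd (past_ZY \<omega>))) \<in> borel_measurable ?V"
      using ZY by measurable
    moreover have "i = 1 \<or> i = 3" using i assms exhaust_3[of i] by auto
    ultimately show ?thesis using True by (auto simp: past_ZY_def)
  next
    case False
    then have s': "s \<in> {..t - 1}" using s by simp
    have "(\<lambda>\<omega>. fst (past_ZY \<omega>) s $ i) \<in> borel_measurable ?V"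
      by (intro borel_measurable_vec_nth measurable_compose[OF measurable_compose[OF ZY measurable_fst] measurable_component_singleton] s')
    then show ?thesis using s' by (simp add: past_ZY_def)
  qed
qed simp

end

section \<open>Conditioning on an extreme value of X\<close>

lemma (in finite_measure_subalgebra) real_cond_exp_mono_bounded:
  assumes "AE x in M. f x \<le> g x" "f \<in> borel_measurable M" "g \<in> borel_measurable M"
    and "\<And>x. \<bar>f x\<bar> \<le> c" "\<And>x. \<bar>g x\<bar> \<le> c"
  shows "AE x in M. real_cond_exp M F f x \<le> real_cond_exp M F g x"
  by (intro real_cond_exp_mono integrable_const_bound[where B=c]) (use assms in auto)

context sre
begin

section \<open>Integrating out the coefficients at times t + 1 and t\<close>

abbreviation exceed :: "real \<Rightarrow> 'w \<Rightarrow> real" where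
  "exceed v \<equiv> indicator {\<omega> \<in> space M. W t \<omega> $ 2 > v}"

definition g :: "real^3 \<Rightarrow> real" where
  "g w = (\<integral>\<omega>. F (A (t + 1) \<omega> $ 3 \<bullet> w + B (t + 1) \<omega> $ 3) \<partial>M)"

text \<open>The counterpart of \<open>g\<close> one step earlier: the conditional probability of
  $X_t > v$ when the state at time \<open>t - 1\<close> is \<open>w\<close>.\<close>

definition h :: "real \<Rightarrow> real^3 \<Rightarrow> real" where
  "h v w = prob {\<omega> \<in> space M. A t \<omega> $ 2 \<bullet> w + B t \<omega> $ 2 > v}"

lemma F_integrable:
  assumes "f \<in> borel_measurable M"
  shows "integrable M (\<lambda>\<omega>. F (f \<omega>))"
  by (rule integrable_const_bound[where B=1])
    (use assms F_nonneg F_less in \<open>auto simp: abs_of_nonneg intro: less_imp_le\<close>)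

lemma g_measurable [measurable]: "g \<in> borel_measurable borel"
  unfolding g_def by measurable

lemma g_nonneg: "0 \<le> g w"
  unfolding g_def by (intro integral_nonneg_AE) (simp add: F_nonneg)

lemma g_less: "g w < 1"
  unfolding g_def by (intro expectation_less F_integrable) (auto simp: F_less)

lemma g_mono:
  assumes "AE \<omega> in M. A (t + 1) \<omega> $ 3 \<bullet> w \<le> A (t + 1) \<omega> $ 3 \<bullet> w'"
  shows "g w \<le> g w'"
  unfolding g_def
  by (intro integral_mono_AE F_integrable) (use assms in \<open>auto elim!: eventually_mono intro!: F_mono\<close>)

lemma h_eq_integral: "h v w = (\<integral>\<omega>. indicator {v<..} (A t \<omega> $ 2 \<bullet> w + B t \<omega> $ 2) \<partial>M)"
proof -
  have "h v w = (\<integral>\<omega>. indicator {\<omega> \<in> space M. A t \<omega> $ 2 \<bullet> w + B t \<omega> $ 2 > v} \<omega> \<partial>M)"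
    unfolding h_def by simp
  also have "\<dots> = (\<integral>\<omega>. indicator {v<..} (A t \<omega> $ 2 \<bullet> w + B t \<omega> $ 2) \<partial>M)"
    by (rule Bochner_Integration.integral_cong) (auto simp: indicator_def)
  finally show ?thesis .
qed

lemma h_measurable [measurable]: "h v \<in> borel_measurable borel"
  unfolding h_eq_integral[abs_def] by measurable

lemma h_nonneg: "0 \<le> h v w" and h_le: "h v w \<le> 1"
  unfolding h_def by simp_all

text \<open>Freezing with row 3 at time \<open>t + 1\<close> against the past of \<open>W\<close> up
  to \<open>t\<close>; the exceedance indicator depends on that past only and is left
  untouched.\<close>

lemma cond_exp_next:
  "AE \<omega> in M. real_cond_exp M (G I) (\<lambda>\<omega>. F (W (t + 1) \<omega> $ 3) * exceed v \<omega>) \<omega> =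
     real_cond_exp M (G I) (\<lambda>\<omega>. g (W t \<omega>) * exceed v \<omega>) \<omega>"
proof -
  interpret finite_measure_subalgebra M "G I" by (rule G_cond_exp)
  let ?\<phi> = "\<lambda>x :: ((real^3) \<times> real) \<times> (int \<Rightarrow> real^3).
    F (fst (fst x) \<bullet> snd x t + snd (fst x)) * indicator {v<..} (snd x t $ 2)"
  have [measurable]: "(\<lambda>p. p t) \<in> borel_measurable (PiM {..t} (\<lambda>_. borel :: (real^3) measure))"
    by (rule measurable_component_singleton) simp
  have \<phi>: "?\<phi> \<in> borel_measurable ((borel \<Otimes>\<^sub>M borel) \<Otimes>\<^sub>M PiM {..t} (\<lambda>_. borel))"
    by measurable
  have "\<bar>?\<phi> x\<bar> \<le> 1" for x
    using F_nonneg F_less by (auto simp: indicator_def abs_of_nonneg intro: less_imp_le)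
  from cond_exp_indep_rv[OF indep_row_3 \<phi> this subalgebra_G sets_G_subset_past_W]
  have "AE \<omega> in M. real_cond_exp M (G I) (\<lambda>\<omega>. F (A (t + 1) \<omega> $ 3 \<bullet> W t \<omega> + B (t + 1) \<omega> $ 3) * indicator {v<..} (W t \<omega> $ 2)) \<omega> =
      real_cond_exp M (G I) (\<lambda>\<omega>. \<integral>\<omega>'. F (A (t + 1) \<omega>' $ 3 \<bullet> W t \<omega> + B (t + 1) \<omega>' $ 3) * indicator {v<..} (W t \<omega> $ 2) \<partial>M) \<omega>"
    by simp
  moreover have "AE \<omega> in M. real_cond_exp M (G I) (\<lambda>\<omega>. F (W (t + 1) \<omega> $ 3) * exceed v \<omega>) \<omega> =
      real_cond_exp M (G I) (\<lambda>\<omega>. F (A (t + 1) \<omega> $ 3 \<bullet> W t \<omega> + B (t + 1) \<omega> $ 3) * indicator {v<..} (W t \<omega> $ 2)) \<omega>"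
  proof (rule real_cond_exp_cong)
    show "AE \<omega> in M. F (W (t + 1) \<omega> $ 3) * exceed v \<omega> =
        F (A (t + 1) \<omega> $ 3 \<bullet> W t \<omega> + B (t + 1) \<omega> $ 3) * indicator {v<..} (W t \<omega> $ 2)"
      using SRE[of "t + 1"] AE_space by eventually_elim (simp add: matrix_vector_mul_component indicator_def)
  qed measurable
  moreover have "AE \<omega> in M. real_cond_exp M (G I) (\<lambda>\<omega>. \<integral>\<omega>'. F (A (t + 1) \<omega>' $ 3 \<bullet> W t \<omega> + B (t + 1) \<omega>' $ 3) * indicator {v<..} (W t \<omega> $ 2) \<partial>M) \<omega> =
      real_cond_exp M (G I) (\<lambda>\<omega>. g (W t \<omega>) * exceed v \<omega>) \<omega>"
  proof (rule real_cond_exp_cong)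
    show "AE \<omega> in M. (\<integral>\<omega>'. F (A (t + 1) \<omega>' $ 3 \<bullet> W t \<omega> + B (t + 1) \<omega>' $ 3) * indicator {v<..} (W t \<omega> $ 2) \<partial>M) =
        g (W t \<omega>) * exceed v \<omega>"
      using AE_space by eventually_elim (simp add: g_def indicator_def)
  qed measurable
  ultimately show ?thesis by eventually_elim simp
qed

lemma cond_exp_exceed:
  assumes I: "2 \<notin> I" and S [measurable]: "S \<in> sets (borel \<Otimes>\<^sub>M borel)"
  shows "AE \<omega> in M. real_cond_exp M (G I) (\<lambda>\<omega>. exceed v \<omega> * indicator S (W (t - 1) \<omega>, W t \<omega> $ 1)) \<omega> =
     real_cond_exp M (G I) (\<lambda>\<omega>. h v (W (t - 1) \<omega>) * indicator S (W (t - 1) \<omega>, W t \<omega> $ 1)) \<omega>"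
proof -
  interpret finite_measure_subalgebra M "G I" by (rule G_cond_exp)
  let ?\<phi> = "\<lambda>x :: ((real^3) \<times> real) \<times> ((int \<Rightarrow> real^3) \<times> (real \<times> real)).
    indicator {v<..} (fst (fst x) \<bullet> fst (snd x) (t - 1) + snd (fst x)) *
      indicator S (fst (snd x) (t - 1), fst (snd (snd x))) :: real"
  have [measurable]: "(\<lambda>p. p (t - 1)) \<in> borel_measurable (PiM {..t - 1} (\<lambda>_. borel :: (real^3) measure))"
    by (rule measurable_component_singleton) simp
  have \<phi>: "?\<phi> \<in> borel_measurable ((borel \<Otimes>\<^sub>M borel) \<Otimes>\<^sub>M (PiM {..t - 1} (\<lambda>_. borel) \<Otimes>\<^sub>M (borel \<Otimes>\<^sub>M borel)))"
    by measurable
  have "\<bar>?\<phi> x\<bar> \<le> 1" for x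
    by (auto simp: indicator_def)
  from cond_exp_indep_rv[OF indep_row_2 \<phi> this subalgebra_G sets_G_subset_past_ZY[OF I]]
  have "AE \<omega> in M. real_cond_exp M (G I) (\<lambda>\<omega>. indicator {v<..} (A t \<omega> $ 2 \<bullet> W (t - 1) \<omega> + B t \<omega> $ 2) * indicator S (W (t - 1) \<omega>, W t \<omega> $ 1)) \<omega> =
      real_cond_exp M (G I) (\<lambda>\<omega>. \<integral>\<omega>'. indicator {v<..} (A t \<omega>' $ 2 \<bullet> W (t - 1) \<omega> + B t \<omega>' $ 2) * indicator S (W (t - 1) \<omega>, W t \<omega> $ 1) \<partial>M) \<omega>"
    by (simp add: past_ZY_def)
  moreover have "AE \<omega> in M. real_cond_exp M (G I) (\<lambda>\<omega>. exceed v \<omega> * indicator S (W (t - 1) \<omega>, W t \<omega> $ 1)) \<omega> =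
      real_cond_exp M (G I) (\<lambda>\<omega>. indicator {v<..} (A t \<omega> $ 2 \<bullet> W (t - 1) \<omega> + B t \<omega> $ 2) * indicator S (W (t - 1) \<omega>, W t \<omega> $ 1)) \<omega>"
  proof (rule real_cond_exp_cong)
    show "AE \<omega> in M. exceed v \<omega> * indicator S (W (t - 1) \<omega>, W t \<omega> $ 1) =
        (indicator {v<..} (A t \<omega> $ 2 \<bullet> W (t - 1) \<omega> + B t \<omega> $ 2) * indicator S (W (t - 1) \<omega>, W t \<omega> $ 1) :: real)"
      using SRE[of t] AE_space by eventually_elim (simp add: matrix_vector_mul_component indicator_def)
  qed measurable
  moreover have "AE \<omega> in M. real_cond_exp M (G I) (\<lambda>\<omega>. \<integral>\<omega>'. indicator {v<..} (A t \<omega>' $ 2 \<bullet> W (t - 1) \<omega> + B t \<omega>' $ 2) * indicator S (W (t - 1) \<omega>, W t \<omega> $ 1) \<partial>M) \<omega> =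
      real_cond_exp M (G I) (\<lambda>\<omega>. h v (W (t - 1) \<omega>) * indicator S (W (t - 1) \<omega>, W t \<omega> $ 1)) \<omega>"
  proof (rule real_cond_exp_cong)
    show "AE \<omega> in M. (\<integral>\<omega>'. indicator {v<..} (A t \<omega>' $ 2 \<bullet> W (t - 1) \<omega> + B t \<omega>' $ 2) * indicator S (W (t - 1) \<omega>, W t \<omega> $ 1) \<partial>M) =
        h v (W (t - 1) \<omega>) * indicator S (W (t - 1) \<omega>, W t \<omega> $ 1)"
      by (simp add: h_eq_integral)
  qed measurable
  ultimately show ?thesis by eventually_elim simp
qed

lemma row_3_nonneg: "AE \<omega> in M. A (t + 1) \<omega> $ 3 $ j \<ge> 0"
proof (cases "prob {\<omega> \<in> space M. A (t + 1) \<omega> $ 3 $ j = 0} = 1")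
  case True
  then have "AE \<omega> in M. A (t + 1) \<omega> $ 3 $ j = 0"
    by (subst (asm) prob_eq_1) (auto elim: eventually_mono)
  then show ?thesis by eventually_elim simp
next
  case False
  from B4[OF this] show ?thesis by eventually_elim simp
qed

text \<open>Since \<open>g\<close> is monotone, $g(W_t)$ on \<open>{X\<^sub>t > v, Z\<^sub>t > - c v}\<close> is at least its value at the
  corner of that region; only the part of the integral where the corner moves to infinity is kept.\<close>

lemma g_lower_limit:
  assumes pos: "AE \<omega> in M. A (t + 1) \<omega> $ 3 $ 2 > 0"
  shows "\<exists>m. (\<forall>n. m n \<le> g (vector [z - c * 2 ^ n, 2 ^ n, y])) \<and>
    m \<longlonglongrightarrow> prob {\<omega> \<in> space M. A (t + 1) \<omega> $ 3 $ 2 > c * A (t + 1) \<omega> $ 3 $ 1}"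
proof (intro exI conjI allI)
  let ?E = "{\<omega> \<in> space M. A (t + 1) \<omega> $ 3 $ 2 > c * A (t + 1) \<omega> $ 3 $ 1}"
  let ?f = "\<lambda>n \<omega>. F (A (t + 1) \<omega> $ 3 \<bullet> vector [z - c * 2 ^ n, 2 ^ n, y] + B (t + 1) \<omega> $ 3)"
  let ?m = "\<lambda>n. \<integral>\<omega>. ?f n \<omega> * indicator ?E \<omega> \<partial>M"
  have int: "integrable M (?f n)" for n
    by (rule F_integrable) measurable
  show "?m n \<le> g (vector [z - c * 2 ^ n, 2 ^ n, y])" for n
    unfolding g_def
    by (intro integral_mono integrable_real_mult_indicator int) (auto simp: indicator_def F_nonneg)
  have "?m \<longlonglongrightarrow> (\<integral>\<omega>. indicator ?E \<omega> \<partial>M)"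
  proof (rule integral_dominated_convergence[where w="\<lambda>_. 1"])
    show "AE \<omega> in M. norm (?f n \<omega> * indicator ?E \<omega>) \<le> 1" for n
      using F_nonneg F_less by (auto simp: indicator_def abs_of_nonneg intro: less_imp_le)
    show "AE \<omega> in M. (\<lambda>n. ?f n \<omega> * indicator ?E \<omega>) \<longlonglongrightarrow> indicator ?E \<omega>"
    proof (intro AE_I2)
      fix \<omega> assume \<omega>: "\<omega> \<in> space M"
      let ?a = "A (t + 1) \<omega> $ 3"
      show "(\<lambda>n. ?f n \<omega> * indicator ?E \<omega>) \<longlonglongrightarrow> indicator ?E \<omega>"
      proof (cases "?a $ 2 > c * ?a $ 1")
        case True
        \<comment> \<open>Along the corner the argument of \<open>F\<close> is affine in
          \<open>2 ^ n\<close>, and its slope is positive exactly on \<open>?E\<close>.\<close>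
        have "filterlim (\<lambda>n::nat. (?a $ 2 - c * ?a $ 1) * 2 ^ n) at_top sequentially"
          by (rule filterlim_tendsto_pos_mult_at_top[OF tendsto_const _ filterlim_power2_at_top]) (use True in simp)
        then have "filterlim (\<lambda>n::nat. (?a $ 1 * z + ?a $ 3 * y + B (t + 1) \<omega> $ 3) + (?a $ 2 - c * ?a $ 1) * 2 ^ n) at_top sequentially"
          by (rule filterlim_tendsto_add_at_top[OF tendsto_const])
        moreover have "(?a $ 1 * z + ?a $ 3 * y + B (t + 1) \<omega> $ 3) + (?a $ 2 - c * ?a $ 1) * 2 ^ n =
            ?a \<bullet> vector [z - c * 2 ^ n, 2 ^ n, y] + B (t + 1) \<omega> $ 3" for n :: nat
          by (simp add: inner_vec_def sum_3 algebra_simps)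
        ultimately have "filterlim (\<lambda>n::nat. ?a \<bullet> vector [z - c * 2 ^ n, 2 ^ n, y] + B (t + 1) \<omega> $ 3) at_top sequentially"
          by simp
        from filterlim_compose[OF F_at_top this] show ?thesis
          using True \<omega> by simp
      qed simp
    qed
  qed auto
  then show "?m \<longlonglongrightarrow> prob ?E" by simp
qed

section \<open>The two cases of the first implication\<close>

lemma cond_exp_ratio_le_1:
  "AE \<omega> in M. cond_exp_event M (G I) (\<lambda>\<omega>. F (W (t + 1) \<omega> $ 3)) {\<omega> \<in> space M. W t \<omega> $ 2 > v} \<omega> \<le> 1"
proof -
  interpret finite_measure_subalgebra M "G I" by (rule G_cond_exp)
  have "AE \<omega> in M. real_cond_exp M (G I) (\<lambda>\<omega>. F (W (t + 1) \<omega> $ 3) * exceed v \<omega>) \<omega>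
      \<le> real_cond_exp M (G I) (exceed v) \<omega>"
    by (rule real_cond_exp_mono_bounded[where c=1])
      (use F_nonneg F_less in \<open>auto simp: indicator_def abs_of_nonneg intro: less_imp_le\<close>)
  moreover have "AE \<omega> in M. 0 \<le> real_cond_exp M (G I) (exceed v) \<omega>"
    by (rule real_cond_exp_pos) auto
  \<comment> \<open>Where the denominator vanishes the quotient has the default value 0, which also
    satisfies the bound.\<close>
  ultimately show ?thesis
    unfolding cond_exp_event_def
    by eventually_elim (auto simp: divide_le_eq_1)
qed

lemma coeff_le_1:
  assumes "extremal_coeff M W F I t \<Gamma>"
  shows "AE \<omega> in M. \<Gamma> \<omega> \<le> 1"
proof -
  have "AE \<omega> in M. \<forall>n. cond_exp_event M (G I) (\<lambda>\<omega>. F (W (t + 1) \<omega> $ 3)) {\<omega> \<in> space M. W t \<omega> $ 2 > 2 ^ n} \<omega> \<le> 1"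
    unfolding AE_all_countable using cond_exp_ratio_le_1 by simp
  with as_limit_sequence[OF assms[unfolded extremal_coeff_def] filterlim_power2_at_top]
  show ?thesis
    by eventually_elim (auto intro: LIMSEQ_le_const2)
qed

lemma measurable_vector_3 [measurable (raw)]:
  assumes [measurable]: "f1 \<in> borel_measurable L" "f2 \<in> borel_measurable L" "f3 \<in> borel_measurable L"
  shows "(\<lambda>x. vector [f1 x, f2 x, f3 x] :: real^3) \<in> borel_measurable L"
  unfolding borel_measurable_vec_iff forall_3 by simp

lemma Y_measurable_G: "(\<lambda>\<omega>. W t \<omega> $ 3) \<in> borel_measurable (G {3})" "(\<lambda>\<omega>. W t \<omega> $ 3) \<in> borel_measurable (G {1, 3})"
  and Z_measurable_G: "(\<lambda>\<omega>. W t \<omega> $ 1) \<in> borel_measurable (G {1, 3})"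
  by (rule measurable_past_sigma; simp)+

lemma g_mono_vec:
  assumes "\<And>j. w $ j \<le> w' $ j"
  shows "g w \<le> g w'"
proof (rule g_mono)
  have "AE \<omega> in M. \<forall>j. A (t + 1) \<omega> $ 3 $ j \<ge> 0"
    unfolding AE_all_countable using row_3_nonneg by simp
  then show "AE \<omega> in M. A (t + 1) \<omega> $ 3 \<bullet> w \<le> A (t + 1) \<omega> $ 3 \<bullet> w'"
    by eventually_elim (auto simp: inner_vec_def intro!: sum_mono mult_left_mono assms)
qed

lemma g_indep_X:
  assumes zero: "AE \<omega> in M. A (t + 1) \<omega> $ 3 $ 2 = 0"
  shows "g w = g (vector [w $ 1, x, w $ 3])"
  by (intro antisym g_mono) (use zero in \<open>eventually_elim, simp add: inner_vec_def sum_3\<close>)+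

lemma cond_exp_exceed_nonneg: "AE \<omega> in M. real_cond_exp M (G I) (exceed v) \<omega> \<ge> 0"
proof -
  interpret finite_measure_subalgebra M "G I" by (rule G_cond_exp)
  show ?thesis by (rule real_cond_exp_pos) auto
qed

text \<open>A lower bound \<open>k\<close> for $g(W_t)$ that is known from the conditioning can be
  pulled out of the conditional expectation. The event \<open>E\<close> is where the bound is valid;
  elsewhere nonnegativity of \<open>g\<close> suffices.\<close>

lemma cond_exp_lower_bound:
  assumes k [measurable]: "k \<in> borel_measurable (G I)" and E [measurable]: "E \<in> sets M"
    and k01: "\<And>\<omega>. 0 \<le> k \<omega>" "\<And>\<omega>. k \<omega> \<le> 1"
    and le: "\<And>\<omega>. \<omega> \<in> E \<Longrightarrow> W t \<omega> $ 2 > v \<Longrightarrow> k \<omega> \<le> g (W t \<omega>)"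
  shows "AE \<omega> in M. k \<omega> * real_cond_exp M (G I) (\<lambda>\<omega>. indicator E \<omega> * exceed v \<omega>) \<omega> \<le>
      real_cond_exp M (G I) (\<lambda>\<omega>. F (W (t + 1) \<omega> $ 3) * exceed v \<omega>) \<omega>"
proof -
  interpret finite_measure_subalgebra M "G I" by (rule G_cond_exp)
  have [measurable]: "k \<in> borel_measurable M"
    by (rule measurable_from_subalg[OF subalgebra_G k])
  have "AE \<omega> in M. real_cond_exp M (G I) (\<lambda>\<omega>. k \<omega> * (indicator E \<omega> * exceed v \<omega>)) \<omega> =
      k \<omega> * real_cond_exp M (G I) (\<lambda>\<omega>. indicator E \<omega> * exceed v \<omega>) \<omega>"
    by (intro real_cond_exp_mult integrable_const_bound[where B=1])
      (use k01 in \<open>auto simp: indicator_def\<close>)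
  moreover have "AE \<omega> in M. real_cond_exp M (G I) (\<lambda>\<omega>. k \<omega> * (indicator E \<omega> * exceed v \<omega>)) \<omega>
      \<le> real_cond_exp M (G I) (\<lambda>\<omega>. g (W t \<omega>) * exceed v \<omega>) \<omega>"
    by (rule real_cond_exp_mono_bounded[where c=1])
      (use k01 le g_nonneg g_less in \<open>auto simp: indicator_def abs_of_nonneg intro: less_imp_le\<close>)
  ultimately show ?thesis
    using cond_exp_next[of I v] by eventually_elim simp
qed

text \<open>By hypothesis, for each \<open>a > 0\<close> an extreme $X_t > v$ is accompanied by $Z_t
  > - a v$ with conditional probability tending to 1. There \<open>g\<close> is at least its value
  at a corner, which bounds the coefficient below by $P(A^y_2 > a A^y_1)$; then \<open>a\<close>
  tends to 0.\<close>

lemma empty_coeff_eq_1: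
  assumes pos: "AE \<omega> in M. A (t + 1) \<omega> $ 3 $ 2 > 0"
    and Z: "\<And>a. a > 0 \<Longrightarrow> as_limit M
      (\<lambda>v. cond_exp_event M (G {3}) (indicator {\<omega> \<in> space M. W t \<omega> $ 1 > - a * v}) {\<omega> \<in> space M. W t \<omega> $ 2 > v}) (\<lambda>_. 1)"
    and \<Gamma>: "extremal_coeff M W F {3} t \<Gamma>"
  shows "AE \<omega> in M. \<Gamma> \<omega> = 1"
proof -
  interpret finite_measure_subalgebra M "G {3}" by (rule G_cond_exp)
  let ?p = "\<lambda>a. prob {\<omega> \<in> space M. A (t + 1) \<omega> $ 3 $ 2 > a * A (t + 1) \<omega> $ 3 $ 1}"
  let ?E = "real_cond_exp M (G {3})"
  note \<Gamma>_lim = as_limit_sequence[OF \<Gamma>[unfolded extremal_coeff_def] filterlim_power2_at_top]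
  have lower: "AE \<omega> in M. ?p a \<le> \<Gamma> \<omega>" if a: "a > 0" for a
  proof -
    let ?S = "\<lambda>n::nat. {\<omega> \<in> space M. W t \<omega> $ 1 > - a * 2 ^ n}"
    \<comment> \<open>The corner of the region, with \<open>Y\<close> kept: it depends on
      \<open>\<omega>\<close> only through the present value of \<open>Y\<close> and is thus
      measurable for the past of \<open>Y\<close>.\<close>
    let ?k = "\<lambda>n \<omega>. g (vector [0 - a * 2 ^ n, 2 ^ n, W t \<omega> $ 3])"
    have "AE \<omega> in M. ?k n \<omega> * ?E (\<lambda>\<omega>. indicator (?S n) \<omega> * exceed (2 ^ n) \<omega>) \<omega> \<le>
      ?E (\<lambda>\<omega>. F (W (t + 1) \<omega> $ 3) * exceed (2 ^ n) \<omega>) \<omega>" for n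
    proof (rule cond_exp_lower_bound)
      show "?k n \<in> borel_measurable (G {3})"
        using Y_measurable_G(1) by measurable
      fix \<omega> assume "\<omega> \<in> ?S n" "W t \<omega> $ 2 > 2 ^ n"
      then have "(vector [0 - a * 2 ^ n, 2 ^ n, W t \<omega> $ 3] :: real^3) $ j \<le> W t \<omega> $ j" for j
        using exhaust_3[of j] by auto
      then show "?k n \<omega> \<le> g (W t \<omega>)" by (rule g_mono_vec)
    qed (auto simp: g_nonneg g_less less_imp_le)
    then have 1: "AE \<omega> in M. \<forall>n. ?k n \<omega> * ?E (\<lambda>\<omega>. indicator (?S n) \<omega> * exceed (2 ^ n) \<omega>) \<omega> \<le>
      ?E (\<lambda>\<omega>. F (W (t + 1) \<omega> $ 3) * exceed (2 ^ n) \<omega>) \<omega>"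
      by (simp add: AE_all_countable)
    have 2: "AE \<omega> in M. \<forall>n. ?E (exceed (2 ^ n)) \<omega> \<ge> 0"
      unfolding AE_all_countable using cond_exp_exceed_nonneg by simp
    have 3: "AE \<omega> in M. \<forall>n. ?E (\<lambda>\<omega>. indicator (?S n) \<omega> * exceed (2 ^ n) \<omega>) \<omega> \<ge> 0"
      unfolding AE_all_countable by (intro allI real_cond_exp_pos) auto
    note 4 = as_limit_sequence[OF Z[OF a] filterlim_power2_at_top]
    from 1 2 3 4 \<Gamma>_lim show ?thesis
    proof eventually_elim
      case (elim \<omega>)
      let ?R = "\<lambda>n. ?E (\<lambda>\<omega>. indicator (?S n) \<omega> * exceed (2 ^ n) \<omega>) \<omega> / ?E (exceed (2 ^ n)) \<omega>"
      let ?Q = "\<lambda>n. ?E (\<lambda>\<omega>. F (W (t + 1) \<omega> $ 3) * exceed (2 ^ n) \<omega>) \<omega> / ?E (exceed (2 ^ n)) \<omega>"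
      obtain m where m: "\<And>n. m n \<le> ?k n \<omega>" "m \<longlonglongrightarrow> ?p a"
        using g_lower_limit[OF pos, of 0 a "W t \<omega> $ 3"] by blast
      have R: "?R \<longlonglongrightarrow> 1" and Q: "?Q \<longlonglongrightarrow> \<Gamma> \<omega>"
        using elim(4,5) unfolding cond_exp_event_def by simp_all
      \<comment> \<open>The quotient \<open>?R\<close> is nonnegative, so \<open>m\<close> may
        replace \<open>?k\<close>; where the common denominator vanishes both sides are 0.\<close>
      have "m n * ?R n \<le> ?Q n" for n
      proof -
        have "m n * ?R n \<le> ?k n \<omega> * ?R n"
          using elim(2,3) by (intro mult_right_mono m) simp
        also have "\<dots> \<le> ?Q n"
          unfolding times_divide_eq_right using elim(1,2) by (intro divide_right_mono) simp_all
        finally show ?thesis .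
      qed
      moreover have "(\<lambda>n. m n * ?R n) \<longlonglongrightarrow> ?p a * 1"
        by (intro tendsto_mult m R)
      ultimately show ?case
        using LIMSEQ_le[OF _ Q] by fastforce
    qed
  qed
  \<comment> \<open>Wherever $A^y_2$ is positive, which is almost everywhere, the inequality holds
    for all sufficiently small \<open>a\<close>. The sequence \<open>1 / Suc k\<close> keeps the
    exceptional null sets countable in number.\<close>
  have p_lim: "(\<lambda>k::nat. ?p (1 / Suc k)) \<longlonglongrightarrow> 1"
  proof -
    let ?I = "\<lambda>k::nat. {\<omega> \<in> space M. A (t + 1) \<omega> $ 3 $ 2 > 1 / Suc k * A (t + 1) \<omega> $ 3 $ 1}"
    have "(\<lambda>k. \<integral>\<omega>. indicator (?I k) \<omega> \<partial>M) \<longlonglongrightarrow> (\<integral>\<omega>. (1::real) \<partial>M)"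
    proof (rule integral_dominated_convergence[where w="\<lambda>_. 1"])
      show "AE \<omega> in M. (\<lambda>k. indicator (?I k) \<omega>) \<longlonglongrightarrow> (1::real)"
        using pos AE_space
      proof eventually_elim
        case (elim \<omega>)
        have "(\<lambda>k. 1 / Suc k * A (t + 1) \<omega> $ 3 $ 1) \<longlonglongrightarrow> 0 * A (t + 1) \<omega> $ 3 $ 1"
          by (intro tendsto_mult tendsto_const LIMSEQ_Suc lim_1_over_n)
        then have "\<forall>\<^sub>F k in sequentially. 1 / Suc k * A (t + 1) \<omega> $ 3 $ 1 < A (t + 1) \<omega> $ 3 $ 2"
          using elim(1) by (intro order_tendstoD(2)) auto
        then show ?case
          by (intro tendsto_eventually) (use elim(2) in \<open>auto elim!: eventually_mono\<close>)
      qed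
    qed (auto simp: indicator_def)
    then show ?thesis by (simp add: prob_space)
  qed
  have "AE \<omega> in M. \<forall>k::nat. ?p (1 / Suc k) \<le> \<Gamma> \<omega>"
    unfolding AE_all_countable by (intro allI lower) simp
  with coeff_le_1[OF \<Gamma>] show ?thesis
  proof eventually_elim
    case (elim \<omega>)
    then show ?case
      using LIMSEQ_le_const2[OF p_lim, of "\<Gamma> \<omega>"] by auto
  qed
qed

text \<open>Without the influence of \<open>X\<close>, the value $g(W_t)$ is a function of $Z_t$ and
  $Y_t$, hence known from the conditioning, and it factors out of the numerator.\<close>

lemma full_coeff_less_1:
  assumes zero: "AE \<omega> in M. A (t + 1) \<omega> $ 3 $ 2 = 0"
    and \<Gamma>: "extremal_coeff M W F {1, 3} t \<Gamma>"
  shows "AE \<omega> in M. \<Gamma> \<omega> < 1"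
proof -
  interpret finite_measure_subalgebra M "G {1, 3}" by (rule G_cond_exp)
  let ?k = "\<lambda>\<omega>. g (vector [W t \<omega> $ 1, 0, W t \<omega> $ 3])" and ?E = "real_cond_exp M (G {1, 3})"
  have k [measurable]: "?k \<in> borel_measurable (G {1, 3})"
    using Y_measurable_G(2) Z_measurable_G by measurable
  have g_k: "(\<lambda>\<omega>. g (W t \<omega>) * exceed v \<omega>) = (\<lambda>\<omega>. ?k \<omega> * exceed v \<omega>)" for v
    by (subst g_indep_X[OF zero]) (rule refl)
  have "AE \<omega> in M. ?E (\<lambda>\<omega>. F (W (t + 1) \<omega> $ 3) * exceed v \<omega>) \<omega> = ?k \<omega> * ?E (exceed v) \<omega>" for v
  proof -
    have "AE \<omega> in M. ?E (\<lambda>\<omega>. ?k \<omega> * exceed v \<omega>) \<omega> = ?k \<omega> * ?E (exceed v) \<omega>"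
      by (intro real_cond_exp_mult integrable_const_bound[where B=1] k)
        (use g_nonneg g_less in \<open>auto simp: indicator_def abs_of_nonneg intro: less_imp_le\<close>)
    with cond_exp_next[of "{1, 3}" v] show ?thesis
      unfolding g_k by eventually_elim simp
  qed
  then have "AE \<omega> in M. \<forall>n. ?E (\<lambda>\<omega>. F (W (t + 1) \<omega> $ 3) * exceed (2 ^ n) \<omega>) \<omega> = ?k \<omega> * ?E (exceed (2 ^ n)) \<omega>"
    by (simp add: AE_all_countable)
  with as_limit_sequence[OF \<Gamma>[unfolded extremal_coeff_def] filterlim_power2_at_top]
  show ?thesis
  proof eventually_elim
    case (elim \<omega>)
    \<comment> \<open>Only an inequality, because the quotient is 0 instead of \<open>?k\<close>
      where the denominator vanishes.\<close>
    have "?k \<omega> * ?E (exceed (2 ^ n)) \<omega> / ?E (exceed (2 ^ n)) \<omega> \<le> ?k \<omega>" for n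
      by (simp add: g_nonneg)
    then have "\<Gamma> \<omega> \<le> ?k \<omega>"
      using elim by (intro LIMSEQ_le_const2[OF elim(1)]) (simp add: cond_exp_event_def)
    then show ?case using g_less le_less_trans by blast
  qed
qed

end

section \<open>Grey's assumption and the two cases of the second implication\<close>

locale sre_grey = sre +
  fixes \<alpha> :: real
  assumes grey: "\<And>j. grey M \<alpha> (\<lambda>\<omega>. A t \<omega> $ 2 $ j) (\<lambda>\<omega>. B t \<omega> $ 2)"
begin

lemma h_tail:
  "\<exists>c>0. \<forall>K. \<forall>\<^sub>F n in sequentially. prob {\<omega> \<in> space M. B t \<omega> $ 2 > 2 ^ n} > 0 \<and>
    (\<forall>w. norm w \<le> K \<longrightarrow> h (2 ^ n) w \<ge> c * prob {\<omega> \<in> space M. B t \<omega> $ 2 > 2 ^ n})"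
  unfolding h_def by (rule grey_tail_lower_bound[OF grey]) measurable

text \<open>At a large power of 2 above \<open>v\<close> the tail comparison gives a positive lower
  bound, and lowering the threshold only increases the probability.\<close>

lemma h_pos: "h v w > 0"
proof -
  obtain c where c: "c > 0" and ev: "\<And>K. \<forall>\<^sub>F n in sequentially. prob {\<omega> \<in> space M. B t \<omega> $ 2 > 2 ^ n} > 0 \<and>
    (\<forall>w. norm w \<le> K \<longrightarrow> h (2 ^ n) w \<ge> c * prob {\<omega> \<in> space M. B t \<omega> $ 2 > 2 ^ n})"
    using h_tail by blast
  have "\<forall>\<^sub>F n in sequentially. (2::real) ^ n \<ge> v"
    using filterlim_power2_at_top unfolding filterlim_at_top by blast
  with ev[of "norm w"] have "\<forall>\<^sub>F n in sequentially. (2::real) ^ n \<ge> v \<and> h (2 ^ n) w > 0"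
    by eventually_elim (use c in \<open>auto intro: less_le_trans[OF mult_pos_pos[OF c]]\<close>)
  then obtain n where n: "(2::real) ^ n \<ge> v" "h (2 ^ n) w > 0"
    using eventually_happens'[OF sequentially_bot] by blast
  have "h (2 ^ n) w \<le> h v w"
    unfolding h_def by (rule finite_measure_mono) (use n(1) in auto)
  with n(2) show ?thesis by simp
qed

text \<open>The conditional probability of the exceedance is the conditional expectation of the
  strictly positive variable $h_v(W_{t-1})$. This excludes the default value 0 of the quotient,
  which would keep the coefficient away from 1.\<close>

lemma cond_exp_exceed_pos: "AE \<omega> in M. real_cond_exp M (G {1, 3}) (exceed v) \<omega> > 0"
proof -
  interpret finite_measure_subalgebra M "G {1, 3}" by (rule G_cond_exp)
  have "AE \<omega> in M. real_cond_exp M (G {1, 3}) (\<lambda>\<omega>. h v (W (t - 1) \<omega>)) \<omega> > 0"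
    by (intro real_cond_exp_gr_c integrable_const_bound[where B=1]) (auto simp: h_nonneg h_le h_pos)
  moreover have "AE \<omega> in M. real_cond_exp M (G {1, 3}) (exceed v) \<omega> = real_cond_exp M (G {1, 3}) (\<lambda>\<omega>. h v (W (t - 1) \<omega>)) \<omega>"
    using cond_exp_exceed[of "{1, 3}" "space (borel \<Otimes>\<^sub>M borel)" v, OF _ sets.top] by (simp add: space_pair_measure)
  ultimately show ?thesis by eventually_elim simp
qed

text \<open>Both $Z_t$ and $Y_t$ are known here, so the corner moves to infinity through its
  \<open>X\<close> coordinate alone, and the positive denominators turn the bound for
  \<open>g\<close> into one for the quotient.\<close>

lemma full_coeff_eq_1:
  assumes pos: "AE \<omega> in M. A (t + 1) \<omega> $ 3 $ 2 > 0"
    and \<Gamma>: "extremal_coeff M W F {1, 3} t \<Gamma>"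
  shows "AE \<omega> in M. \<Gamma> \<omega> = 1"
proof -
  interpret finite_measure_subalgebra M "G {1, 3}" by (rule G_cond_exp)
  let ?E = "real_cond_exp M (G {1, 3})"
  \<comment> \<open>The term \<open>0 * 2 ^ n\<close> casts the corner in the form of
    \<open>g_lower_limit\<close> with slope \<open>c = 0\<close>.\<close>
  let ?k = "\<lambda>n \<omega>. g (vector [W t \<omega> $ 1 - 0 * 2 ^ n, 2 ^ n, W t \<omega> $ 3])"
  have "AE \<omega> in M. ?k n \<omega> * ?E (\<lambda>\<omega>. indicator (space M) \<omega> * exceed (2 ^ n) \<omega>) \<omega> \<le>
    ?E (\<lambda>\<omega>. F (W (t + 1) \<omega> $ 3) * exceed (2 ^ n) \<omega>) \<omega>" for n
  proof (rule cond_exp_lower_bound)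
    show "?k n \<in> borel_measurable (G {1, 3})"
      using Y_measurable_G(2) Z_measurable_G by measurable
    fix \<omega> assume "W t \<omega> $ 2 > 2 ^ n"
    then have "(vector [W t \<omega> $ 1 - 0 * 2 ^ n, 2 ^ n, W t \<omega> $ 3] :: real^3) $ j \<le> W t \<omega> $ j" for j
      using exhaust_3[of j] by auto
    then show "?k n \<omega> \<le> g (W t \<omega>)" by (rule g_mono_vec)
  qed (auto simp: g_nonneg g_less less_imp_le)
  moreover have "(\<lambda>\<omega>. indicator (space M) \<omega> * exceed v \<omega>) = exceed v" for v
    by (auto simp: indicator_def)
  ultimately have 1: "AE \<omega> in M. \<forall>n. ?k n \<omega> * ?E (exceed (2 ^ n)) \<omega> \<le>
    ?E (\<lambda>\<omega>. F (W (t + 1) \<omega> $ 3) * exceed (2 ^ n) \<omega>) \<omega>"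
    by (simp add: AE_all_countable)
  have 2: "AE \<omega> in M. \<forall>n. ?E (exceed (2 ^ n)) \<omega> > 0"
    unfolding AE_all_countable using cond_exp_exceed_pos by simp
  from 1 2 as_limit_sequence[OF \<Gamma>[unfolded extremal_coeff_def] filterlim_power2_at_top] coeff_le_1[OF \<Gamma>]
  show ?thesis
  proof eventually_elim
    case (elim \<omega>)
    obtain m where m: "\<And>n. m n \<le> ?k n \<omega>"
      "m \<longlonglongrightarrow> prob {\<omega> \<in> space M. A (t + 1) \<omega> $ 3 $ 2 > 0 * A (t + 1) \<omega> $ 3 $ 1}"
      using g_lower_limit[OF pos, of "W t \<omega> $ 1" 0 "W t \<omega> $ 3"] by blast
    moreover have "prob {\<omega> \<in> space M. A (t + 1) \<omega> $ 3 $ 2 > 0 * A (t + 1) \<omega> $ 3 $ 1} = 1"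
      using pos by (subst prob_eq_1) auto
    ultimately have m1: "m \<longlonglongrightarrow> 1" by simp
    have "m n \<le> ?E (\<lambda>\<omega>. F (W (t + 1) \<omega> $ 3) * exceed (2 ^ n) \<omega>) \<omega> / ?E (exceed (2 ^ n)) \<omega>" for n
    proof -
      have "m n * ?E (exceed (2 ^ n)) \<omega> \<le> ?k n \<omega> * ?E (exceed (2 ^ n)) \<omega>"
        using elim(2) by (intro mult_right_mono m) (simp add: less_imp_le)
      also have "\<dots> \<le> ?E (\<lambda>\<omega>. F (W (t + 1) \<omega> $ 3) * exceed (2 ^ n) \<omega>) \<omega>"
        using elim(1) by blast
      finally show ?thesis
        using elim(2) by (simp add: pos_le_divide_eq)
    qed
    then have "1 \<le> \<Gamma> \<omega>"
      using LIMSEQ_le[OF m1 elim(3)] by (simp add: cond_exp_event_def)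
    with elim(4) show ?case by simp
  qed
qed

text \<open>On a bounded event \<open>?D\<close> the deficit $1 - g(W_t)$ stays away from 0 given
  $Y_t$, and within $X_t > 2^n$ this event keeps a nonvanishing conditional share: at least a
  multiple of the tail of $B^x$ by Grey's assumption, against at most a multiple of it by the limsup
  condition. A coefficient equal to 1 would force \<open>?D\<close> to be null.\<close>

lemma empty_coeff_not_1:
  assumes zero: "AE \<omega> in M. A (t + 1) \<omega> $ 3 $ 2 = 0"
    and limsup: "as_limsup_finite M (\<lambda>u \<omega>. real_cond_exp M (G {3}) (exceed u) \<omega> / prob {\<omega> \<in> space M. B t \<omega> $ 2 > u})"
    and \<Gamma>: "extremal_coeff M W F {3} t \<Gamma>"
  shows "\<not> (AE \<omega> in M. \<Gamma> \<omega> = 1)"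
proof
  assume \<Gamma>1: "AE \<omega> in M. \<Gamma> \<omega> = 1"
  interpret finite_measure_subalgebra M "G {3}" by (rule G_cond_exp)
  let ?E = "real_cond_exp M (G {3})"
  \<comment> \<open>The bound on the previous state makes the tail comparison uniform; the upper
    bound on $Z_t$ limits \<open>g\<close>. These events exhaust the space, so one of them has
    positive probability.\<close>
  let ?D = "\<lambda>K::nat. {\<omega> \<in> space M. norm (W (t - 1) \<omega>) \<le> K \<and> W t \<omega> $ 1 \<le> K}"
  have "\<exists>K. prob (?D K) \<noteq> 0"
  proof (rule ccontr)
    assume "\<not> (\<exists>K. prob (?D K) \<noteq> 0)"
    then have "AE \<omega> in M. \<not> (norm (W (t - 1) \<omega>) \<le> K \<and> W t \<omega> $ 1 \<le> K)" for K :: nat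
      by (subst (asm) prob_eq_0) auto
    then have "AE \<omega> in M. \<forall>K::nat. \<not> (norm (W (t - 1) \<omega>) \<le> K \<and> W t \<omega> $ 1 \<le> K)"
      unfolding AE_all_countable by blast
    then have "AE \<omega> in M. False"
    proof eventually_elim
      case (elim \<omega>)
      obtain K :: nat where "max (norm (W (t - 1) \<omega>)) (W t \<omega> $ 1) \<le> K"
        using real_arch_simple by blast
      with elim show ?case by auto
    qed
    then show False by simp
  qed
  then obtain K where K: "prob (?D K) \<noteq> 0" by blast
  define S where "S = {w :: real^3. norm w \<le> K} \<times> {..real K}"
  have [measurable]: "S \<in> sets (borel \<Otimes>\<^sub>M borel)"
    unfolding S_def by (intro pair_measureI) auto
  \<comment> \<open>The indicator of \<open>?D K\<close>, expressed through \<open>S\<close> to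
    match \<open>cond_exp_exceed\<close>.\<close>
  define d :: "'a \<Rightarrow> real" where "d \<omega> = indicator S (W (t - 1) \<omega>, W t \<omega> $ 1)" for \<omega>
  have [measurable]: "d \<in> borel_measurable M"
    unfolding d_def by measurable
  have d01: "0 \<le> d \<omega>" "d \<omega> \<le> 1" for \<omega>
    by (auto simp: d_def indicator_def)
  have intd: "integrable M d"
    by (rule integrable_const_bound[where B=1]) (auto simp: d01 abs_of_nonneg)
  obtain c where c: "c > 0" and ev: "\<And>K. \<forall>\<^sub>F n in sequentially. prob {\<omega> \<in> space M. B t \<omega> $ 2 > 2 ^ n} > 0 \<and>
    (\<forall>w. norm w \<le> K \<longrightarrow> h (2 ^ n) w \<ge> c * prob {\<omega> \<in> space M. B t \<omega> $ 2 > 2 ^ n})"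
    using h_tail by blast
  let ?p = "\<lambda>n::nat. prob {\<omega> \<in> space M. B t \<omega> $ 2 > 2 ^ n}"
  obtain n0 where n0: "\<And>n. n \<ge> n0 \<Longrightarrow> ?p n > 0" "\<And>n w. n \<ge> n0 \<Longrightarrow> norm w \<le> K \<Longrightarrow> h (2 ^ n) w \<ge> c * ?p n"
    using ev[of "real K"] unfolding eventually_sequentially by blast
  \<comment> \<open>An upper bound for $g(W_t)$ on \<open>?D K\<close>; the second coordinate is
    arbitrary, since \<open>g\<close> does not depend on it when the coefficient of \<open>X\<close>
    vanishes.\<close>
  let ?k = "\<lambda>\<omega>. g (vector [real K, 0, W t \<omega> $ 3])"
  have [measurable]: "?k \<in> borel_measurable (G {3})"
    using Y_measurable_G(1) by measurable
  have [measurable]: "?k \<in> borel_measurable M"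
    by measurable
  have 1: "AE \<omega> in M. c * ?p n * ?E d \<omega> \<le> ?E (\<lambda>\<omega>. exceed (2 ^ n) \<omega> * d \<omega>) \<omega>" if n: "n \<ge> n0" for n
  proof -
    have "AE \<omega> in M. ?E (\<lambda>\<omega>. c * ?p n * d \<omega>) \<omega> = c * ?p n * ?E d \<omega>"
      by (rule real_cond_exp_cmult[OF intd])
    moreover have "AE \<omega> in M. ?E (\<lambda>\<omega>. c * ?p n * d \<omega>) \<omega> \<le> ?E (\<lambda>\<omega>. h (2 ^ n) (W (t - 1) \<omega>) * d \<omega>) \<omega>"
    proof (rule real_cond_exp_mono)
      show "AE \<omega> in M. c * ?p n * d \<omega> \<le> h (2 ^ n) (W (t - 1) \<omega>) * d \<omega>"
        using n0(2)[OF n] by (auto simp: d_def S_def indicator_def)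
      show "integrable M (\<lambda>\<omega>. h (2 ^ n) (W (t - 1) \<omega>) * d \<omega>)"
        by (rule integrable_const_bound[where B=1])
          (auto simp: abs_mult d01 h_nonneg h_le abs_of_nonneg intro!: mult_le_one)
    qed (use intd in simp)
    moreover have "AE \<omega> in M. ?E (\<lambda>\<omega>. exceed (2 ^ n) \<omega> * d \<omega>) \<omega> = ?E (\<lambda>\<omega>. h (2 ^ n) (W (t - 1) \<omega>) * d \<omega>) \<omega>"
      unfolding d_def by (rule cond_exp_exceed) auto
    ultimately show ?thesis by eventually_elim simp
  qed
  \<comment> \<open>The deficit $1 - g(W_t)$ is nonnegative everywhere and at least
    \<open>1 - ?k\<close> on \<open>?D K\<close>; the latter is known from the past of
    \<open>Y\<close> and factors out.\<close>
  have 2: "AE \<omega> in M. (1 - ?k \<omega>) * ?E (\<lambda>\<omega>. exceed v \<omega> * d \<omega>) \<omega> \<le>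
      ?E (exceed v) \<omega> - ?E (\<lambda>\<omega>. F (W (t + 1) \<omega> $ 3) * exceed v \<omega>) \<omega>" for v
  proof -
    have int_g: "integrable M (\<lambda>\<omega>. g (W t \<omega>) * exceed v \<omega>)"
      by (rule integrable_const_bound[where B=1])
        (use g_nonneg g_less in \<open>auto simp: indicator_def abs_of_nonneg intro: less_imp_le\<close>)
    have int_e: "integrable M (exceed v)"
      by (rule integrable_const_bound[where B=1]) auto
    have k_bound: "\<bar>1 - g w\<bar> \<le> 1" for w
      using g_nonneg[of w] g_less[of w] by linarith
    have int_k: "integrable M (\<lambda>\<omega>. (1 - ?k \<omega>) * (exceed v \<omega> * d \<omega>))"
      by (rule integrable_const_bound[where B=1])
        (auto simp: indicator_def d_def k_bound)
    have "AE \<omega> in M. ?E (\<lambda>\<omega>. (1 - ?k \<omega>) * (exceed v \<omega> * d \<omega>)) \<omega> = (1 - ?k \<omega>) * ?E (\<lambda>\<omega>. exceed v \<omega> * d \<omega>) \<omega>"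
      by (rule real_cond_exp_mult[OF _ _ int_k]) measurable
    moreover have "AE \<omega> in M. ?E (\<lambda>\<omega>. (1 - ?k \<omega>) * (exceed v \<omega> * d \<omega>)) \<omega> \<le>
        ?E (\<lambda>\<omega>. exceed v \<omega> - g (W t \<omega>) * exceed v \<omega>) \<omega>"
    proof (rule real_cond_exp_mono[OF _ int_k Bochner_Integration.integrable_diff[OF int_e int_g]])
      have "g (W t \<omega>) \<le> ?k \<omega>" if "W t \<omega> $ 1 \<le> K" for \<omega>
      proof -
        have "(vector [W t \<omega> $ 1, 0, W t \<omega> $ 3] :: real^3) $ j \<le> (vector [real K, 0, W t \<omega> $ 3] :: real^3) $ j" for j
          using exhaust_3[of j] that by auto
        then show ?thesis
          unfolding g_indep_X[OF zero, of "W t \<omega>" 0] by (rule g_mono_vec)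
      qed
      then show "AE \<omega> in M. (1 - ?k \<omega>) * (exceed v \<omega> * d \<omega>) \<le> exceed v \<omega> - g (W t \<omega>) * exceed v \<omega>"
        by (auto simp: d_def S_def indicator_def g_less less_imp_le)
    qed
    moreover have "AE \<omega> in M. ?E (\<lambda>\<omega>. exceed v \<omega> - g (W t \<omega>) * exceed v \<omega>) \<omega> =
        ?E (exceed v) \<omega> - ?E (\<lambda>\<omega>. g (W t \<omega>) * exceed v \<omega>) \<omega>"
      by (rule real_cond_exp_diff[OF int_e int_g])
    ultimately show ?thesis
      using cond_exp_next[of "{3}" v] by eventually_elim simp
  qed
  have "AE \<omega> in M. \<forall>n. n \<ge> n0 \<longrightarrow> c * ?p n * ?E d \<omega> \<le> ?E (\<lambda>\<omega>. exceed (2 ^ n) \<omega> * d \<omega>) \<omega>"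
    using 1 by (simp add: AE_all_countable)
  moreover have "AE \<omega> in M. \<forall>n. (1 - ?k \<omega>) * ?E (\<lambda>\<omega>. exceed (2 ^ n) \<omega> * d \<omega>) \<omega> \<le>
      ?E (exceed (2 ^ n)) \<omega> - ?E (\<lambda>\<omega>. F (W (t + 1) \<omega> $ 3) * exceed (2 ^ n) \<omega>) \<omega>"
    using 2 by (simp add: AE_all_countable)
  moreover have "AE \<omega> in M. \<forall>n. ?E (exceed (2 ^ n)) \<omega> \<ge> 0"
    unfolding AE_all_countable using cond_exp_exceed_nonneg by simp
  ultimately have "AE \<omega> in M. ?E d \<omega> \<le> 0"
    using \<Gamma>1 as_limit_sequence[OF \<Gamma>[unfolded extremal_coeff_def] filterlim_power2_at_top]
      as_limsup_finite_sequence[OF limsup filterlim_power2_at_top]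
  proof eventually_elim
    case (elim \<omega>)
    show ?case
    proof (rule ccontr)
      let ?P = "\<lambda>n. ?E (exceed (2 ^ n)) \<omega>" and ?Q = "\<lambda>n. ?E (\<lambda>\<omega>. F (W (t + 1) \<omega> $ 3) * exceed (2 ^ n) \<omega>) \<omega>"
      assume "\<not> ?E d \<omega> \<le> 0"
      \<comment> \<open>Combining both estimates, \<open>\<kappa> * ?p n\<close> is a lower bound
        for the gap between denominator and numerator.\<close>
      define \<kappa> where "\<kappa> = (1 - ?k \<omega>) * (c * ?E d \<omega>)"
      have \<kappa>: "\<kappa> > 0"
        unfolding \<kappa>_def using \<open>\<not> ?E d \<omega> \<le> 0\<close> c g_less by (intro mult_pos_pos) auto
      obtain C where C: "\<forall>\<^sub>F n in sequentially. ?P n / ?p n \<le> C"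
        using elim(6) by blast
      have lim: "(\<lambda>n. ?Q n / ?P n) \<longlonglongrightarrow> 1"
        using elim(4,5) by (simp add: cond_exp_event_def)
      \<comment> \<open>Positivity of the quotient excludes a zero denominator.\<close>
      then have "\<forall>\<^sub>F n in sequentially. ?Q n / ?P n > 0"
        by (rule order_tendstoD(1)) simp
      \<comment> \<open>The maximum with 1 supplies a positive constant to divide by, as the sign of
        \<open>C\<close> is unknown.\<close>
      with C eventually_ge_at_top[of n0]
      have "\<forall>\<^sub>F n in sequentially. ?Q n / ?P n \<le> 1 - \<kappa> / max C 1"
      proof eventually_elim
        case n: (elim n)
        have p: "?p n > 0" using n0(1) n by simp
        have "\<kappa> * ?p n \<le> (1 - ?k \<omega>) * ?E (\<lambda>\<omega>. exceed (2 ^ n) \<omega> * d \<omega>) \<omega>"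
          unfolding \<kappa>_def mult.assoc using elim(1) n g_less
          by (intro mult_left_mono) (auto simp: mult_ac less_imp_le)
        also have "\<dots> \<le> ?P n - ?Q n" using elim(2) by simp
        finally have le: "\<kappa> * ?p n \<le> ?P n - ?Q n" .
        have "?P n \<noteq> 0" using n by auto
        then have P: "?P n > 0"
          using elim(3) by (simp add: order_less_le)
        have "?P n \<le> C * ?p n" using n p by (simp add: pos_divide_le_eq)
        also have "\<dots> \<le> max C 1 * ?p n" using p by (intro mult_right_mono) auto
        finally have "\<kappa> * ?P n \<le> \<kappa> * (max C 1 * ?p n)" using \<kappa> by (intro mult_left_mono) auto
        also have "\<dots> = max C 1 * (\<kappa> * ?p n)" by simp
        also have "\<dots> \<le> max C 1 * (?P n - ?Q n)" using le by (intro mult_left_mono) auto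
        finally have "\<kappa> / max C 1 * ?P n \<le> ?P n - ?Q n"
          by (simp add: pos_divide_le_eq mult.commute)
        then have "\<kappa> / max C 1 \<le> (?P n - ?Q n) / ?P n"
          using P by (simp add: pos_le_divide_eq)
        then show ?case using P by (simp add: diff_divide_distrib)
      qed
      then have "1 \<le> 1 - \<kappa> / max C 1"
        using tendsto_upperbound[OF lim] by simp
      moreover have "\<kappa> / max C 1 > 0" using \<kappa> by simp
      ultimately show False by simp
    qed
  qed
  \<comment> \<open>Integrating the conditional expectation recovers the probability of
    \<open>?D K\<close>, which would be at most 0.\<close>
  then have "(\<integral>\<omega>. ?E d \<omega> \<partial>M) \<le> (\<integral>\<omega>. 0 \<partial>M)"
    by (intro integral_mono_AE real_cond_exp_int(1)[OF intd]) auto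
  then have "(\<integral>\<omega>. d \<omega> \<partial>M) \<le> 0"
    using real_cond_exp_int(2)[OF intd] by simp
  moreover have "(\<integral>\<omega>. d \<omega> \<partial>M) = (\<integral>\<omega>. indicator (?D K) \<omega> \<partial>M)"
    by (rule Bochner_Integration.integral_cong) (auto simp: d_def S_def indicator_def)
  ultimately show False
    using K measure_nonneg[of M "?D K"] by simp
qed

end

section \<open>Both implications by cases on the coefficient of X\<close>

theorem theorem1:
  fixes M :: "'w measure"
    and A :: "int \<Rightarrow> 'w \<Rightarrow> real^3^3"
    and B W :: "int \<Rightarrow> 'w \<Rightarrow> real^3"
    and N :: "real measure" and F :: "real \<Rightarrow> real"
    and \<Gamma>C \<Gamma>0 :: "'w \<Rightarrow> real"
    and \<alpha>x :: real and t :: int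
  assumes prob: "prob_space M"
    and iid: "iid_family M (\<lambda>s \<omega>. (A s \<omega>, B s \<omega>))"
    and W_meas: "\<And>s. W s \<in> borel_measurable M"
    and SRE: "\<And>s. AE \<omega> in M. W s \<omega> = A s \<omega> *v W (s - 1) \<omega> + B s \<omega>"
    and W_series: "\<And>s. AE \<omega> in M.
          (\<lambda>i. back_prod (\<lambda>r. A r \<omega>) s i *v B (s - int i) \<omega>) sums W s \<omega>"
    and supp: "\<And>s i. i \<in> {2, 3} \<Longrightarrow> supported_near_infinity M (\<lambda>\<omega>. B s \<omega> $ i)"
    and B1: "\<And>s. ereal_expectation M (\<lambda>\<omega>. ereal_log (onorm ((*v) (A s \<omega>)))) < 0"
            "\<And>s. (\<integral>\<^sup>+\<omega>. ennreal (max (ln (norm (B s \<omega>))) 0) \<partial>M) < \<infinity>"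
    and B2: "\<And>s. prob_space.indep_vars M (\<lambda>_. borel) (\<lambda>i \<omega>. (A s \<omega> $ i, B s \<omega> $ i)) (UNIV :: 3 set)"
    and B4: "\<And>s i j. measure M {\<omega> \<in> space M. A s \<omega> $ i $ j = 0} \<noteq> 1 \<Longrightarrow>
               AE \<omega> in M. A s \<omega> $ i $ j > 0"
    and F: "real_distribution N" "F = cdf N" "\<And>x. F x < 1"
    and \<Gamma>C: "extremal_coeff M W F {1, 3} t \<Gamma>C"
    and \<Gamma>0: "extremal_coeff M W F {3} t \<Gamma>0"
  shows "((\<forall>a>0. as_limit M
            (\<lambda>v. cond_exp_event M (past_sigma M W {3} t)
                   (indicator {\<omega> \<in> space M. W t \<omega> $ 1 > - a * v})
                   {\<omega> \<in> space M. W t \<omega> $ 2 > v})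
            (\<lambda>_. 1)) \<longrightarrow>
         (AE \<omega> in M. \<Gamma>C \<omega> = 1) \<longrightarrow> (AE \<omega> in M. \<Gamma>0 \<omega> = 1)) \<and>
         ((\<forall>j. grey M \<alpha>x (\<lambda>\<omega>. A t \<omega> $ 2 $ j) (\<lambda>\<omega>. B t \<omega> $ 2)) \<and>
         as_limsup_finite M
           (\<lambda>u \<omega>. real_cond_exp M (past_sigma M W {3} t)
                     (indicator {\<omega> \<in> space M. W t \<omega> $ 2 > u}) \<omega>
                   / measure M {\<omega> \<in> space M. B t \<omega> $ 2 > u}) \<longrightarrow>
         (AE \<omega> in M. \<Gamma>0 \<omega> = 1) \<longrightarrow> (AE \<omega> in M. \<Gamma>C \<omega> = 1))"
proof (intro conjI impI)
  interpret sre M A B W N F t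
    using prob iid W_meas SRE W_series B2 B4 F unfolding sre_def sre_axioms_def by blast
  have cases: "(AE \<omega> in M. A (t + 1) \<omega> $ 3 $ 2 = 0) \<or> (AE \<omega> in M. A (t + 1) \<omega> $ 3 $ 2 > 0)"
  proof (cases "prob {\<omega> \<in> space M. A (t + 1) \<omega> $ 3 $ 2 = 0} = 1")
    case True
    then show ?thesis by (subst (asm) prob_eq_1) (auto elim: eventually_mono)
  qed (use B4 in blast)
  {
    assume Z: "\<forall>a>0. as_limit M
            (\<lambda>v. cond_exp_event M (past_sigma M W {3} t)
                   (indicator {\<omega> \<in> space M. W t \<omega> $ 1 > - a * v})
                   {\<omega> \<in> space M. W t \<omega> $ 2 > v})
            (\<lambda>_. 1)" and "AE \<omega> in M. \<Gamma>C \<omega> = 1"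
    from cases show "AE \<omega> in M. \<Gamma>0 \<omega> = 1"
    proof
      \<comment> \<open>The premise is impossible in this case, since the coefficient given both
        pasts is almost surely below 1.\<close>
      assume "AE \<omega> in M. A (t + 1) \<omega> $ 3 $ 2 = 0"
      from full_coeff_less_1[OF this \<Gamma>C] \<open>AE \<omega> in M. \<Gamma>C \<omega> = 1\<close>
      have "AE \<omega> in M. False" by eventually_elim simp
      then show ?thesis by simp
    next
      assume "AE \<omega> in M. A (t + 1) \<omega> $ 3 $ 2 > 0"
      then show ?thesis
        by (rule empty_coeff_eq_1) (use Z \<Gamma>0 in blast)+
    qed
  next
    assume hyp: "(\<forall>j. grey M \<alpha>x (\<lambda>\<omega>. A t \<omega> $ 2 $ j) (\<lambda>\<omega>. B t \<omega> $ 2)) \<and>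
         as_limsup_finite M
           (\<lambda>u \<omega>. real_cond_exp M (past_sigma M W {3} t)
                     (indicator {\<omega> \<in> space M. W t \<omega> $ 2 > u}) \<omega>
                   / prob {\<omega> \<in> space M. B t \<omega> $ 2 > u})" and one: "AE \<omega> in M. \<Gamma>0 \<omega> = 1"
    interpret sre_grey M A B W N F t \<alpha>x
      by unfold_locales (use hyp in blast)
    from cases show "AE \<omega> in M. \<Gamma>C \<omega> = 1"
    proof
      \<comment> \<open>Again the premise fails: the coefficient given the past of \<open>Y\<close>
        is not almost surely equal to 1.\<close>
      assume "AE \<omega> in M. A (t + 1) \<omega> $ 3 $ 2 = 0"
      from empty_coeff_not_1[OF this conjunct2[OF hyp] \<Gamma>0] one show ?thesis by blast
    next
      assume "AE \<omega> in M. A (t + 1) \<omega> $ 3 $ 2 > 0"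
      then show ?thesis by (rule full_coeff_eq_1[OF _ \<Gamma>C])
    qed
  }
qed

end
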